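(* Let $(G,P)$ be a framework of $n$ vertices in general position in $\mathbb{R}^d$, $d\le n-1$, where $G$ is a $(d+1)$-lateration graph. Then $(G,P)$ admits a positive semidefinite stress matrix with rank $n-d-1$. Moreover, such a stress matrix can be computed exactly in strongly polynomial time, namely in $\mathcal{O}(n^3+nd^3)$ arithmetic operations, if the lateration ordering and the position matrix $P$ are known.
   Context: A framework $(G,P)$ in $\mathbb{R}^d$ consists of a simple graph $G$ with vertex set $\{1,\dots,n\}$ and edge set $E(G)$ together with a position matrix $P=[p_1,\dots,p_n]\in\mathbb{R}^{d\times n}$ whose columns (the point $p_i$ is assigned to vertex $i$) affinely span $\mathbb{R}^d$. The extended position matrix is the $(d+1)\times n$ matrix $A=\begin{pmatrix}P\\ e^T\end{pmatrix}$, where $e\in\mathbb{R}^n$ is the all-ones vector. The framework is in general position in $\mathbb{R}^d$ if no $d+1$ of the points $p_1,\dots,p_n$ are affinely dependent. A stress matrix of $(G,P)$ is a real symmetric $n\times n$ matrix $S$ with $AS=0$ and $S_{ij}=0$ for all $i\neq j$ with $(i,j)\notin E(G)$. A graph on $n$ vertices is a $(d+1)$-lateration graph if there is a permutation $\pi$ of the vertices (the lateration ordering) such that the first $d+1$ vertices $\pi(1),\dots,\pi(d+1)$ form a clique, and each remaining vertex $\pi(j)$, $j=d+2,\dots,n$, is adjacent to $d+1$ vertices in the set $\{\pi(1),\dots,\pi(j-1)\}$ (so $\pi(j)$ has exactly $d+1$ neighbours preceding it). "Computed exactly" refers to counting real arithmetic operations. *)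

theory Defs
  imports
    "Jordan_Normal_Form.DL_Rank"
    "HOL-Combinatorics.Permutations"
begin

section \<open>Frameworks, general position, stress matrices, lateration graphs\<close>

text \<open>
  Vertices are numbered \<open>0, \<dots>, n - 1\<close>; the point of vertex \<open>i\<close> is \<open>col P i\<close>.
  An undirected edge is a two-element set of vertices.
\<close>

definition simple_graph :: "nat \<Rightarrow> nat set set \<Rightarrow> bool" where
  "simple_graph n E \<longleftrightarrow> (\<forall>e\<in>E. \<exists>i<n. \<exists>j<n. i \<noteq> j \<and> e = {i, j})"

definition columns_affinely_span :: "nat \<Rightarrow> nat \<Rightarrow> real mat \<Rightarrow> bool" where
  "columns_affinely_span d n P \<longleftrightarrow>
     (\<forall>x\<in>carrier_vec d. \<exists>c\<in>carrier_vec n. (\<Sum>i<n. c $ i) = 1 \<and> P *\<^sub>v c = x)"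

definition framework :: "nat \<Rightarrow> nat \<Rightarrow> nat set set \<Rightarrow> real mat \<Rightarrow> bool" where
  "framework d n E P \<longleftrightarrow>
     simple_graph n E \<and> P \<in> carrier_mat d n \<and> columns_affinely_span d n P"

text \<open>
  Affine dependence of the family of columns indexed by \<open>I\<close>. It is a property of the
  family, not of the set of its values: a repeated point is a dependence.
\<close>

definition columns_affinely_dependent :: "nat \<Rightarrow> real mat \<Rightarrow> nat set \<Rightarrow> bool" where
  "columns_affinely_dependent d P I \<longleftrightarrow>
     (\<exists>c :: nat \<Rightarrow> real. (\<exists>i\<in>I. c i \<noteq> 0) \<and> (\<Sum>i\<in>I. c i) = 0 \<and>
        (\<forall>r<d. (\<Sum>i\<in>I. c i * P $$ (r, i)) = 0))"

definition general_position :: "nat \<Rightarrow> nat \<Rightarrow> real mat \<Rightarrow> bool" where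
  "general_position d n P \<longleftrightarrow>
     (\<forall>I \<subseteq> {..<n}. card I = d + 1 \<longrightarrow> \<not> columns_affinely_dependent d P I)"

definition extended_position_matrix :: "nat \<Rightarrow> nat \<Rightarrow> real mat \<Rightarrow> real mat" where
  "extended_position_matrix d n P = mat (d + 1) n (\<lambda>(i, j). if i < d then P $$ (i, j) else 1)"

definition stress_matrix :: "nat \<Rightarrow> nat \<Rightarrow> nat set set \<Rightarrow> real mat \<Rightarrow> real mat \<Rightarrow> bool" where
  "stress_matrix d n E P S \<longleftrightarrow>
     S \<in> carrier_mat n n \<and> S\<^sup>T = S \<and>
     extended_position_matrix d n P * S = 0\<^sub>m (d + 1) n \<and>
     (\<forall>i<n. \<forall>j<n. i \<noteq> j \<longrightarrow> {i, j} \<notin> E \<longrightarrow> S $$ (i, j) = 0)"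

definition positive_semidefinite :: "nat \<Rightarrow> real mat \<Rightarrow> bool" where
  "positive_semidefinite n S \<longleftrightarrow>
     S \<in> carrier_mat n n \<and> S\<^sup>T = S \<and> (\<forall>x\<in>carrier_vec n. x \<bullet> (S *\<^sub>v x) \<ge> 0)"

text \<open>
  The parameter \<open>k\<close> is the size of the initial clique, \<open>k = d + 1\<close> in the application.
  Positions in the ordering \<open>\<pi>\<close> are numbered from \<open>0\<close> as well.
\<close>

definition lateration_ordering :: "nat \<Rightarrow> nat \<Rightarrow> nat set set \<Rightarrow> (nat \<Rightarrow> nat) \<Rightarrow> bool" where
  "lateration_ordering k n E \<pi> \<longleftrightarrow>
     \<pi> permutes {..<n} \<and>
     (\<forall>i<k. \<forall>j<k. i \<noteq> j \<longrightarrow> {\<pi> i, \<pi> j} \<in> E) \<and>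
     (\<forall>j. k \<le> j \<and> j < n \<longrightarrow> card {i. i < j \<and> {\<pi> i, \<pi> j} \<in> E} = k)"

definition lateration_graph :: "nat \<Rightarrow> nat \<Rightarrow> nat set set \<Rightarrow> bool" where
  "lateration_graph k n E \<longleftrightarrow> (\<exists>\<pi>. lateration_ordering k n E \<pi>)"


section \<open>Real-number programs with unit costs\<close>

text \<open>
  A while language over a memory of scalar index registers, two-dimensional arrays of
  natural numbers (adjacency, permutations) and two-dimensional arrays of exact reals.
  Programs are finite and their constants are integers. On reals they have the four field
  operations and comparisons, but no rounding, roots or conversion to indices; division by
  zero has no result, so execution gets stuck there. Index arithmetic is limited to
  addition and truncated subtraction, so that no long computation can be packed into
  index registers at unit cost.

  The cost of an execution is the number of elementary steps of any kind: every
  constant, memory access, arithmetic operation, test and assignment costs one unit. It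
  bounds in particular the number of real arithmetic operations.
\<close>

record state =
  ireg :: "nat \<Rightarrow> nat"
  iarr :: "nat \<Rightarrow> nat \<Rightarrow> nat \<Rightarrow> nat"
  rarr :: "nat \<Rightarrow> nat \<Rightarrow> nat \<Rightarrow> real"

datatype iexp =
    IConst nat
  | IReg nat
  | IAt nat iexp iexp
  | IAdd iexp iexp
  | ISub iexp iexp

datatype rexp =
    RConst int
  | RAt nat iexp iexp
  | RAdd rexp rexp
  | RSub rexp rexp
  | RMul rexp rexp
  | RDiv rexp rexp

datatype bexp =
    ILess iexp iexp
  | IEq iexp iexp
  | RLess rexp rexp
  | REq rexp rexp
  | BNot bexp
  | BAnd bexp bexp

datatype com =
    Skip
  | IAssign nat iexp
  | IStore nat iexp iexp iexp
  | RStore nat iexp iexp rexp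
  | Seq com com
  | Cond bexp com com
  | While bexp com

primrec ival :: "iexp \<Rightarrow> state \<Rightarrow> nat" where
  "ival (IConst k) s = k"
| "ival (IReg x) s = ireg s x"
| "ival (IAt a e f) s = iarr s a (ival e s) (ival f s)"
| "ival (IAdd e f) s = ival e s + ival f s"
| "ival (ISub e f) s = ival e s - ival f s"

primrec icost :: "iexp \<Rightarrow> nat" where
  "icost (IConst k) = 1"
| "icost (IReg x) = 1"
| "icost (IAt a e f) = 1 + icost e + icost f"
| "icost (IAdd e f) = 1 + icost e + icost f"
| "icost (ISub e f) = 1 + icost e + icost f"

primrec rval :: "rexp \<Rightarrow> state \<Rightarrow> real" where
  "rval (RConst k) s = of_int k"
| "rval (RAt a e f) s = rarr s a (ival e s) (ival f s)"
| "rval (RAdd e f) s = rval e s + rval f s"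
| "rval (RSub e f) s = rval e s - rval f s"
| "rval (RMul e f) s = rval e s * rval f s"
| "rval (RDiv e f) s = rval e s / rval f s"

primrec rdefined :: "rexp \<Rightarrow> state \<Rightarrow> bool" where
  "rdefined (RConst k) s \<longleftrightarrow> True"
| "rdefined (RAt a e f) s \<longleftrightarrow> True"
| "rdefined (RAdd e f) s \<longleftrightarrow> rdefined e s \<and> rdefined f s"
| "rdefined (RSub e f) s \<longleftrightarrow> rdefined e s \<and> rdefined f s"
| "rdefined (RMul e f) s \<longleftrightarrow> rdefined e s \<and> rdefined f s"
| "rdefined (RDiv e f) s \<longleftrightarrow> rdefined e s \<and> rdefined f s \<and> rval f s \<noteq> 0"

primrec rcost :: "rexp \<Rightarrow> nat" where
  "rcost (RConst k) = 1"
| "rcost (RAt a e f) = 1 + icost e + icost f"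
| "rcost (RAdd e f) = 1 + rcost e + rcost f"
| "rcost (RSub e f) = 1 + rcost e + rcost f"
| "rcost (RMul e f) = 1 + rcost e + rcost f"
| "rcost (RDiv e f) = 1 + rcost e + rcost f"

primrec bval :: "bexp \<Rightarrow> state \<Rightarrow> bool" where
  "bval (ILess e f) s \<longleftrightarrow> ival e s < ival f s"
| "bval (IEq e f) s \<longleftrightarrow> ival e s = ival f s"
| "bval (RLess e f) s \<longleftrightarrow> rval e s < rval f s"
| "bval (REq e f) s \<longleftrightarrow> rval e s = rval f s"
| "bval (BNot b) s \<longleftrightarrow> \<not> bval b s"
| "bval (BAnd b c) s \<longleftrightarrow> bval b s \<and> bval c s"

primrec bdefined :: "bexp \<Rightarrow> state \<Rightarrow> bool" where
  "bdefined (ILess e f) s \<longleftrightarrow> True"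
| "bdefined (IEq e f) s \<longleftrightarrow> True"
| "bdefined (RLess e f) s \<longleftrightarrow> rdefined e s \<and> rdefined f s"
| "bdefined (REq e f) s \<longleftrightarrow> rdefined e s \<and> rdefined f s"
| "bdefined (BNot b) s \<longleftrightarrow> bdefined b s"
| "bdefined (BAnd b c) s \<longleftrightarrow> bdefined b s \<and> bdefined c s"

primrec bcost :: "bexp \<Rightarrow> nat" where
  "bcost (ILess e f) = 1 + icost e + icost f"
| "bcost (IEq e f) = 1 + icost e + icost f"
| "bcost (RLess e f) = 1 + rcost e + rcost f"
| "bcost (REq e f) = 1 + rcost e + rcost f"
| "bcost (BNot b) = 1 + bcost b"
| "bcost (BAnd b c) = 1 + bcost b + bcost c"

text \<open>
  \<open>exec c s t s'\<close>: started in \<open>s\<close>, the program \<open>c\<close> halts in \<open>s'\<close> after \<open>t\<close> steps.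
\<close>

inductive exec :: "com \<Rightarrow> state \<Rightarrow> nat \<Rightarrow> state \<Rightarrow> bool" where
  Skip: "exec Skip s 0 s"
| IAssign: "exec (IAssign x e) s (1 + icost e) (s\<lparr>ireg := (ireg s)(x := ival e s)\<rparr>)"
| IStore: "exec (IStore a e f g) s (1 + icost e + icost f + icost g)
    (s\<lparr>iarr := (iarr s)(a := (iarr s a)(ival e s := (iarr s a (ival e s))(ival f s := ival g s)))\<rparr>)"
| RStore: "rdefined g s \<Longrightarrow> exec (RStore a e f g) s (1 + icost e + icost f + rcost g)
    (s\<lparr>rarr := (rarr s)(a := (rarr s a)(ival e s := (rarr s a (ival e s))(ival f s := rval g s)))\<rparr>)"
| Seq: "exec c s t s' \<Longrightarrow> exec c' s' t' s'' \<Longrightarrow> exec (Seq c c') s (t + t') s''"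
| CondTrue: "bdefined b s \<Longrightarrow> bval b s \<Longrightarrow> exec c s t s' \<Longrightarrow>
    exec (Cond b c c') s (1 + bcost b + t) s'"
| CondFalse: "bdefined b s \<Longrightarrow> \<not> bval b s \<Longrightarrow> exec c' s t s' \<Longrightarrow>
    exec (Cond b c c') s (1 + bcost b + t) s'"
| WhileFalse: "bdefined b s \<Longrightarrow> \<not> bval b s \<Longrightarrow> exec (While b c) s (1 + bcost b) s"
| WhileTrue: "bdefined b s \<Longrightarrow> bval b s \<Longrightarrow> exec c s t s' \<Longrightarrow> exec (While b c) s' t' s'' \<Longrightarrow>
    exec (While b c) s (1 + bcost b + t + t') s''"

text \<open>
  Input layout: \<open>n\<close> and \<open>d\<close> in registers \<open>0\<close> and \<open>1\<close>; the ordering \<open>\<pi>\<close> in column \<open>0\<close> of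
  index array \<open>0\<close>; the adjacency matrix in index array \<open>1\<close>; \<open>P\<close> in real array \<open>0\<close>.
  The remaining memory is arbitrary. The output is the \<open>n \<times> n\<close> matrix in real array \<open>1\<close>.
\<close>

definition holds_input ::
  "state \<Rightarrow> nat \<Rightarrow> nat \<Rightarrow> nat set set \<Rightarrow> real mat \<Rightarrow> (nat \<Rightarrow> nat) \<Rightarrow> bool" where
  "holds_input s d n E P \<pi> \<longleftrightarrow>
     ireg s 0 = n \<and> ireg s 1 = d \<and>
     (\<forall>i<n. iarr s 0 i 0 = \<pi> i) \<and>
     (\<forall>i<n. \<forall>j<n. iarr s 1 i j = (if {i, j} \<in> E then 1 else 0)) \<and>
     (\<forall>i<d. \<forall>j<n. rarr s 0 i j = P $$ (i, j))"

definition output_matrix :: "nat \<Rightarrow> state \<Rightarrow> real mat" where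
  "output_matrix n s = mat n n (\<lambda>(i, j). rarr s 1 i j)"

end

theory Submission
  imports Defs
begin

text \<open>
  Number the vertices by their positions \<open>0, \<dots>, n - 1\<close> in the lateration ordering and let \<open>A\<close> be the
  extended position matrix with columns in this order. The stress matrix is sought in the form
  \<open>S = \<Sum> u\<^sub>k u\<^sub>k\<^sup>T\<close> with \<open>k\<close> running over the \<open>n - d - 1\<close> positions after the initial clique, where \<open>u\<^sub>k\<close>
  has entry \<open>1\<close> at \<open>k\<close> and \<open>0\<close> at all later positions. Then \<open>S\<close> is positive semidefinite, and it has
  rank \<open>n - d - 1\<close> because the vectors \<open>u\<^sub>k\<close> are triangular. It remains to achieve \<open>A u\<^sub>k = 0\<close> and
  \<open>S\<^sub>i\<^sub>k = 0\<close> for nonadjacent \<open>i < k\<close>.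

  As \<open>u\<^sub>l\<close> vanishes at \<open>k\<close> for \<open>l < k\<close>, the entry \<open>S\<^sub>i\<^sub>k\<close> equals \<open>u\<^sub>k(i) + \<Sum> u\<^sub>l(i) u\<^sub>l(k)\<close>, summed over \<open>l > k\<close>.
  If the vectors are determined for decreasing \<open>k\<close>, the condition \<open>S\<^sub>i\<^sub>k = 0\<close> therefore prescribes
  \<open>u\<^sub>k(i)\<close> at every earlier nonneighbour \<open>i\<close> of \<open>k\<close>. Only the entries at the \<open>d + 1\<close> earlier neighbours
  remain, and \<open>A u\<^sub>k = 0\<close> is a linear system of \<open>d + 1\<close> equations for them. General position makes it
  regular (\<open>general_position_rows_independent\<close>). The properties of the resulting \<open>S\<close> are proved in
  \<open>stress_columns_yield_stress\<close>.

  The program carries out this construction. The prescribed entries of one vector are \<open>O(n)\<close> sums of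
  length at most \<open>n\<close>. The system is solved by successive projection: a matrix \<open>H\<close> projects onto the
  orthogonal complement of the rows treated so far, and each row costs one correction of the
  solution along \<open>H q\<close> and one rank-one update of \<open>H\<close>, where \<open>q\<close> is the row (\<open>projector_step\<close>). That is
  \<open>O(n + d\<^sup>2)\<close> for a row and \<open>O(n d + d\<^sup>3)\<close> for a vector, with no pivoting. Over all vectors, and with the final
  product, this adds up to \<open>O(n\<^sup>3 + n d\<^sup>3)\<close>. The existence of the stress matrix is then read off the output
  of the program (\<open>stress_program_correct\<close>).
\<close>

section \<open>Solving linear systems by successive projection\<close>

definition rows_independent :: "nat \<Rightarrow> (nat \<Rightarrow> nat \<Rightarrow> real) \<Rightarrow> bool" where
  "rows_independent D q \<longleftrightarrow>
     (\<forall>c. (\<forall>a<D. (\<Sum>j<D. c j * q j a) = 0) \<longrightarrow> (\<forall>j<D. c j = 0))"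

text \<open>
  The rows \<open>q 0, q 1, \<dots>\<close> of a linear system are handled one at a time. After \<open>r\<close> of them, \<open>H\<close> is
  the orthogonal projection of \<open>\<real>\<^sup>D\<close> onto the complement of \<open>span {q 0, \<dots>, q (r - 1)}\<close>. This is
  recorded by the three properties that are inductive under a rank-one update: symmetry, orthogonality
  of the range to the processed rows, and \<open>H = I\<close> modulo their span.
\<close>

definition projector :: "nat \<Rightarrow> (nat \<Rightarrow> nat \<Rightarrow> real) \<Rightarrow> nat \<Rightarrow> (nat \<Rightarrow> nat \<Rightarrow> real) \<Rightarrow> bool" where
  "projector D q r H \<longleftrightarrow>
     (\<forall>a<D. \<forall>b<D. H a b = H b a) \<and>
     (\<forall>j<r. \<forall>b<D. (\<Sum>a<D. q j a * H a b) = 0) \<and>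
     (\<exists>c. \<forall>a<D. \<forall>b<D. H a b = of_bool (a = b) + (\<Sum>j<r. c j b * q j a))"

lemma projector_identity: "projector D q 0 (\<lambda>a b. of_bool (a = b))"
  by (auto simp: projector_def)

lemma projector_cong:
  assumes "projector D q r H" and "\<And>a b. a < D \<Longrightarrow> b < D \<Longrightarrow> H' a b = H a b"
  shows "projector D q r H'"
proof -
  have "(\<Sum>a<D. q j a * H' a b) = (\<Sum>a<D. q j a * H a b)" if "b < D" for j b
    using assms(2) that by simp
  moreover have "H' a b = H a b \<and> H' b a = H b a" if "a < D" "b < D" for a b
    using assms(2) that by simp
  ultimately show ?thesis using assms(1) unfolding projector_def by (simp cong: conj_cong)
qed

text \<open>
  Moving along \<open>p = H q\<^sub>r\<close> does not disturb the processed equations, since \<open>p\<close> is orthogonal to their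
  rows. It can satisfy equation \<open>r\<close> because the pivot \<open>w = p \<bullet> q\<^sub>r\<close> is not zero: \<open>p\<close> and \<open>q\<^sub>r\<close> differ by
  a combination of the earlier rows, to which \<open>p\<close> is orthogonal, so \<open>w = p \<bullet> p\<close>; and \<open>p = 0\<close> would be a
  linear dependence of \<open>q\<^sub>r\<close> on the earlier rows. Each equation thus costs \<open>O(D\<^sup>2)\<close> operations, and no
  search for a nonzero pivot is involved.
\<close>

lemma
  fixes q H :: "nat \<Rightarrow> nat \<Rightarrow> real"
  assumes H: "projector D q r H" and ind: "rows_independent D q" and r: "r < D"
  defines "p \<equiv> \<lambda>a. \<Sum>b<D. H a b * q r b"
  defines "w \<equiv> \<Sum>a<D. p a * q r a"
  shows projection_orthogonal: "j < r \<Longrightarrow> (\<Sum>a<D. q j a * p a) = 0"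
    and projection_pivot_nonzero: "w \<noteq> 0"
    and projector_step: "projector D q (Suc r) (\<lambda>a b. H a b - p a * p b / w)"
proof -
  have sym: "H a b = H b a" if "a < D" "b < D" for a b
    using H that by (auto simp: projector_def)
  have orth: "(\<Sum>a<D. q j a * H a b) = 0" if "j < r" "b < D" for j b
    using H that by (auto simp: projector_def)
  obtain c where c: "H a b = of_bool (a = b) + (\<Sum>j<r. c j b * q j a)" if "a < D" "b < D" for a b
    using H by (auto simp: projector_def)
  have orth_p: "(\<Sum>a<D. q j a * p a) = 0" if "j < r" for j
  proof -
    have "(\<Sum>a<D. q j a * p a) = (\<Sum>b<D. (\<Sum>a<D. q j a * H a b) * q r b)"
      unfolding p_def sum_distrib_left sum_distrib_right
      by (subst sum.swap) (simp add: mult.assoc)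
    also have "\<dots> = 0" using orth[OF that] by simp
    finally show ?thesis .
  qed
  show "(\<Sum>a<D. q j a * p a) = 0" if "j < r" using orth_p[OF that] .
  define e where "e j = (\<Sum>b<D. c j b * q r b)" for j
  have p_comb: "p a = q r a + (\<Sum>j<r. e j * q j a)" if "a < D" for a
  proof -
    have "p a = (\<Sum>b<D. of_bool (a = b) * q r b + (\<Sum>j<r. c j b * q r b * q j a))"
      unfolding p_def using c[OF that]
      by (intro sum.cong refl) (simp only: lessThan_iff distrib_right sum_distrib_right, simp add: mult_ac)
    also have "\<dots> = (\<Sum>b<D. of_bool (a = b) * q r b) + (\<Sum>b<D. \<Sum>j<r. c j b * q r b * q j a)"
      by (rule sum.distrib)
    also have "(\<Sum>b<D. of_bool (a = b) * q r b) = (\<Sum>b<D. if a = b then q r b else 0)"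
      by (intro sum.cong) auto
    also have "\<dots> = q r a" using that by simp
    also have "(\<Sum>b<D. \<Sum>j<r. c j b * q r b * q j a) = (\<Sum>j<r. e j * q j a)"
      unfolding e_def sum_distrib_right by (rule sum.swap)
    finally show ?thesis .
  qed
  \<comment> \<open>The pivot is a sum of squares.\<close>
  have w_sq: "w = (\<Sum>a<D. p a * p a)"
  proof -
    have "(\<Sum>a<D. p a * p a) = (\<Sum>a<D. p a * q r a + (\<Sum>j<r. e j * (q j a * p a)))"
      by (intro sum.cong refl, subst (2) p_comb)
         (auto simp: distrib_left sum_distrib_left ac_simps)
    also have "\<dots> = w + (\<Sum>j<r. e j * (\<Sum>a<D. q j a * p a))"
      unfolding w_def sum.distrib sum_distrib_left by (subst (2) sum.swap) (rule refl)
    also have "\<dots> = w" using orth_p by simp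
    finally show ?thesis by simp
  qed
  show w: "w \<noteq> 0"
  proof
    assume "w = 0"
    then have "\<forall>a\<in>{..<D}. p a * p a = 0"
      unfolding w_sq by (subst (asm) sum_nonneg_eq_0_iff) auto
    then have p0: "p a = 0" if "a < D" for a using that by simp
    \<comment> \<open>If \<open>p = 0\<close>, these are the coefficients of a dependence of row \<open>r\<close> on the earlier rows.\<close>
    define e' where "e' j = (if j = r then 1 else if j < r then e j else 0)" for j
    have "(\<Sum>j<D. e' j * q j a) = 0" if "a < D" for a
    proof -
      have "(\<Sum>j<D. e' j * q j a) = (\<Sum>j<Suc r. e' j * q j a)"
        using r by (intro sum.mono_neutral_right) (auto simp: e'_def)
      also have "\<dots> = p a" using p_comb[OF that] by (simp add: e'_def)
      finally show ?thesis using p0[OF that] by simp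
    qed
    then have "e' r = 0" using ind r unfolding rows_independent_def by blast
    then show False by (simp add: e'_def)
  qed
  have comb: "H a b - p a * p b / w = of_bool (a = b) +
      (\<Sum>j<Suc r. (if j = r then - (p b / w) else c j b - e j * (p b / w)) * q j a)"
    if "a < D" "b < D" for a b
  proof -
    have "H a b - p a * p b / w = of_bool (a = b) + (\<Sum>j<r. c j b * q j a)
        - (q r a + (\<Sum>j<r. e j * q j a)) * (p b / w)"
      using c[OF that] p_comb[OF that(1)] by simp
    also have "\<dots> = of_bool (a = b) + ((\<Sum>j<r. (c j b - e j * (p b / w)) * q j a) - p b / w * q r a)"
      by (simp add: algebra_simps sum_subtractf sum_distrib_left)
    finally show ?thesis by simp
  qed
  show "projector D q (Suc r) (\<lambda>a b. H a b - p a * p b / w)"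
    unfolding projector_def
  proof (intro conjI allI impI)
    fix a b assume "a < D" "b < D"
    then show "H a b - p a * p b / w = H b a - p b * p a / w" using sym by (simp add: mult.commute)
  next
    fix j b assume j: "j < Suc r" and b: "b < D"
    have "(\<Sum>a<D. q j a * (H a b - p a * p b / w)) =
        (\<Sum>a<D. q j a * H a b) - (\<Sum>a<D. q j a * p a) * p b / w"
      by (simp add: right_diff_distrib sum_subtractf sum_distrib_right sum_divide_distrib mult.assoc)
    also have "\<dots> = 0"
    proof (cases "j = r")
      case True
      have "(\<Sum>a<D. q r a * H a b) = p b"
        unfolding p_def using sym b by (intro sum.cong) (auto simp: mult.commute)
      moreover have "(\<Sum>a<D. q r a * p a) = w" unfolding w_def by (simp add: mult.commute)
      ultimately show ?thesis using True w by simp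
    next
      case False
      then show ?thesis using j orth[OF _ b] orth_p by simp
    qed
    finally show "(\<Sum>a<D. q j a * (H a b - p a * p b / w)) = 0" .
  next
    show "\<exists>c. \<forall>a<D. \<forall>b<D. H a b - p a * p b / w = of_bool (a = b) + (\<Sum>j<Suc r. c j b * q j a)"
      using comb by (intro exI[of _ "\<lambda>j b. if j = r then - (p b / w) else c j b - e j * (p b / w)"]) blast
  qed
qed

text \<open>
  General position makes columns of the extended position matrix independent, whereas the projection
  method consumes rows. For a square matrix the two are linked by \<open>det M\<^sup>T = det M\<close>.
\<close>

lemma rows_independent_if_columns_independent:
  fixes q :: "nat \<Rightarrow> nat \<Rightarrow> real"
  assumes "\<And>c. (\<forall>r<D. (\<Sum>a<D. q r a * c a) = 0) \<Longrightarrow> \<forall>a<D. c a = 0"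
  shows "rows_independent D q"
proof -
  define M where "M = mat D D (\<lambda>(r, a). q r a)"
  have M: "M \<in> carrier_mat D D" by (simp add: M_def)
  have mult: "(M *\<^sub>v v) $ r = (\<Sum>a<D. q r a * v $ a)" if "r < D" "v \<in> carrier_vec D" for v r
    using that by (auto simp: M_def scalar_prod_def atLeast0LessThan intro!: sum.cong)
  have multT: "(M\<^sup>T *\<^sub>v v) $ a = (\<Sum>r<D. v $ r * q r a)" if "a < D" "v \<in> carrier_vec D" for v a
    using that by (auto simp: M_def scalar_prod_def atLeast0LessThan intro!: sum.cong)
  have "det M \<noteq> 0"
  proof
    assume "det M = 0"
    then obtain v where v: "v \<in> carrier_vec D" "v \<noteq> 0\<^sub>v D" "M *\<^sub>v v = 0\<^sub>v D"
      using det_0_iff_vec_prod_zero_field[OF M] by blast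
    then have "\<forall>r<D. (\<Sum>a<D. q r a * v $ a) = 0" using mult by (metis index_zero_vec(1))
    then have "\<forall>a<D. v $ a = 0" using assms[of "\<lambda>a. v $ a"] by blast
    then show False using v by (auto intro!: eq_vecI)
  qed
  then have det: "det M\<^sup>T \<noteq> 0" using det_transpose[OF M] by simp
  show ?thesis unfolding rows_independent_def
  proof (intro allI impI)
    fix c j assume c: "\<forall>a<D. (\<Sum>j<D. c j * q j a) = 0" and j: "j < D"
    have "M\<^sup>T *\<^sub>v vec D c = 0\<^sub>v D"
      using c multT[of _ "vec D c"] M by (auto intro!: eq_vecI)
    then have "vec D c = 0\<^sub>v D"
      using det det_0_iff_vec_prod_zero_field[of "M\<^sup>T" D] M vec_carrier[of D c]
      by (metis transpose_carrier_mat)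
    then show "c j = 0" using j by (metis index_vec index_zero_vec(1))
  qed
qed

section \<open>Stress matrices from triangular factors\<close>

definition extended_entry :: "nat \<Rightarrow> real mat \<Rightarrow> nat \<Rightarrow> nat \<Rightarrow> real" where
  "extended_entry d P r v = (if r < d then P $$ (r, v) else 1)"

text \<open>
  Column \<open>k\<close> of a factor \<open>U\<close> with \<open>S = U U\<^sup>T\<close>; rows and columns are indexed by positions in the
  lateration ordering. The first two conditions make \<open>U\<close> unit upper triangular, the last one says
  that the column is orthogonal to the rows of the extended position matrix. The third one is
  \<open>S\<^sub>i\<^sub>k = 0\<close> solved for \<open>U\<^sub>i\<^sub>k\<close>: as \<open>U\<^sub>k\<^sub>l = 0\<close> for \<open>l < k\<close> and \<open>U\<^sub>k\<^sub>k = 1\<close>, the entry \<open>S\<^sub>i\<^sub>k\<close> involves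
  only the columns \<open>l \<ge> k\<close>.
\<close>

definition stress_column ::
  "nat \<Rightarrow> nat \<Rightarrow> nat set set \<Rightarrow> real mat \<Rightarrow> (nat \<Rightarrow> nat) \<Rightarrow> (nat \<Rightarrow> nat \<Rightarrow> real) \<Rightarrow> nat \<Rightarrow> bool" where
  "stress_column d n E P \<pi> U k \<longleftrightarrow>
     U k k = 1 \<and> (\<forall>i. k < i \<and> i < n \<longrightarrow> U i k = 0) \<and>
     (\<forall>i<k. {\<pi> i, \<pi> k} \<notin> E \<longrightarrow> U i k = - (\<Sum>l=Suc k..<n. U i l * U k l)) \<and>
     (\<forall>r\<le>d. (\<Sum>i<n. extended_entry d P r (\<pi> i) * U i k) = 0)"

lemma (in vec_space) rank_le_sum_of_outer_products:
  fixes f :: "'b \<Rightarrow> nat \<Rightarrow> 'a"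
  assumes "finite L"
  shows "rank (mat n n (\<lambda>(i, j). \<Sum>l\<in>L. f l i * g l j)) \<le> card L"
  using assms
proof (induction L)
  case empty
  have zero: "mat n n (\<lambda>(i, j). \<Sum>l\<in>{}. f l i * g l j) = 0\<^sub>m n n" by (intro eq_matI) auto
  show ?case unfolding zero rank_0I by simp
next
  case (insert x L)
  have "mat n n (\<lambda>(i, j). \<Sum>l\<in>insert x L. f l i * g l j) =
      mat n n (\<lambda>(i, j). f x i * g x j) + mat n n (\<lambda>(i, j). \<Sum>l\<in>L. f l i * g l j)"
    using insert.hyps by (intro eq_matI) auto
  moreover have "rank (mat n n (\<lambda>(i, j). f x i * g x j)) \<le> 1"
    by (rule rank_le_1_product_entries[where f = "f x" and g = "g x"]) auto
  ultimately show ?case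
    using rank_subadditive[of "mat n n (\<lambda>(i, j). f x i * g x j)" n
        "mat n n (\<lambda>(i, j). \<Sum>l\<in>L. f l i * g l j)"] insert by fastforce
qed

text \<open>
  Independence is expressed by a trivial kernel and the columns are selected by a map \<open>J\<close>; injectivity
  of \<open>J\<close>, and distinctness of the selected columns, follow from the kernel condition.
\<close>

lemma (in vec_space) rank_ge_independent_columns:
  assumes A: "A \<in> carrier_mat n nc" and J: "\<And>t. t < m \<Longrightarrow> J t < nc"
    and ind: "\<And>c. (\<forall>i<n. (\<Sum>t<m. A $$ (i, J t) * c t) = 0) \<Longrightarrow> \<forall>t<m. c t = 0"
  shows "m \<le> rank A"
proof -
  define B where "B = mat n m (\<lambda>(i, t). A $$ (i, J t))"
  have B: "B \<in> carrier_mat n m" by (simp add: B_def)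
  have "set (cols B) \<subseteq> set (cols A)"
  proof
    fix x assume "x \<in> set (cols B)"
    then obtain t where t: "t < m" "x = col B t" using B by (auto simp: cols_def)
    then have "x = col A (J t)" using A J by (auto simp: B_def intro!: eq_vecI)
    then show "x \<in> set (cols A)" using A J t by (auto simp: cols_def)
  qed
  have inj: "v = 0\<^sub>v m" if v: "v \<in> carrier_vec m" "B *\<^sub>v v = 0\<^sub>v n" for v
  proof -
    have "(\<Sum>t<m. A $$ (i, J t) * v $ t) = 0" if "i < n" for i
    proof -
      have "(B *\<^sub>v v) $ i = (\<Sum>t<m. A $$ (i, J t) * v $ t)"
        using that v(1) by (auto simp: B_def scalar_prod_def atLeast0LessThan intro!: sum.cong)
      then show ?thesis unfolding v(2) using that by simp
    qed
    then have "\<forall>t<m. v $ t = 0" using ind[of "\<lambda>t. v $ t"] by blast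
    then show ?thesis using v by (auto intro!: eq_vecI)
  qed
  have dist: "distinct (cols B)"
  proof (rule ccontr)
    assume "\<not> distinct (cols B)"
    then obtain s t where st: "s < m" "t < m" "s \<noteq> t" "col B s = col B t"
      using B by (auto simp: distinct_conv_nth)
    \<comment> \<open>Equal columns would put a difference of two unit vectors into the kernel.\<close>
    have unit: "B *\<^sub>v unit_vec m t = col B t" if "t < m" for t
      using B that by (intro eq_vecI) auto
    have "B *\<^sub>v (unit_vec m s - unit_vec m t) = col B s - col B t"
      using st by (simp add: mult_minus_distrib_mat_vec[OF B] unit)
    also have "\<dots> = 0\<^sub>v n" using st B by auto
    finally have "unit_vec m s - unit_vec m t = (0\<^sub>v m :: 'a vec)" by (intro inj) auto
    then have "(unit_vec m s - unit_vec m t) $ s = (0\<^sub>v m :: 'a vec) $ s" by simp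
    then show False using st by simp
  qed
  have "lin_indpt (set (cols B))"
    using lin_depE[OF B _ dist] inj by metis
  moreover have "card (set (cols B)) = m"
    using dist B by (simp add: distinct_card)
  ultimately show ?thesis
    using rank_ge_card_indpt[OF A \<open>set (cols B) \<subseteq> set (cols A)\<close>] by simp
qed

lemma upper_triangular_kernel_trivial:
  fixes U :: "nat \<Rightarrow> nat \<Rightarrow> 'a :: idom"
  assumes diag: "\<And>l. m \<le> l \<Longrightarrow> l < n \<Longrightarrow> U l l \<noteq> 0"
    and below: "\<And>i l. m \<le> l \<Longrightarrow> l < i \<Longrightarrow> i < n \<Longrightarrow> U i l = 0"
    and ker: "\<And>l. m \<le> l \<Longrightarrow> l < n \<Longrightarrow> (\<Sum>i=m..<n. c i * U i l) = 0"
    and j: "m \<le> j" "j < n"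
  shows "c j = 0"
  using j
proof (induction j rule: less_induct)
  case (less j)
  have "(\<Sum>i=m..<n. c i * U i j) = (\<Sum>i\<in>{j}. c i * U i j)"
  proof (rule sum.mono_neutral_right)
    show "\<forall>i\<in>{m..<n} - {j}. c i * U i j = 0"
    proof
      fix i assume "i \<in> {m..<n} - {j}"
      then show "c i * U i j = 0"
        using less below[of j i] by (cases "i < j") auto
    qed
  qed (use less in auto)
  then show ?case using ker[OF less.prems] diag[OF less.prems] by simp
qed

text \<open>
  The quadratic form of \<open>S = U U\<^sup>T\<close> is \<open>\<Sum>\<^sub>l (U\<^sub>l \<bullet> c)\<^sup>2\<close>. It is nonnegative, and for a vector \<open>c\<close> supported
  on the positions after the initial clique it vanishes only if \<open>c = 0\<close>, because \<open>U\<close> is triangular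
  there. Hence the \<open>n - d - 1\<close> columns of \<open>S\<close> at these positions are independent, while \<open>S\<close> is a sum
  of \<open>n - d - 1\<close> matrices of rank at most one.
\<close>

lemma stress_columns_yield_stress:
  assumes lat: "lateration_ordering (d + 1) n E \<pi>"
    and cols: "\<And>k. d < k \<Longrightarrow> k < n \<Longrightarrow> stress_column d n E P \<pi> U k"
    and S: "S \<in> carrier_mat n n"
      "\<And>i j. i < n \<Longrightarrow> j < n \<Longrightarrow> S $$ (\<pi> i, \<pi> j) = (\<Sum>l=Suc d..<n. U i l * U j l)"
  shows "stress_matrix d n E P S \<and> positive_semidefinite n S \<and> vec_space.rank n S = n - d - 1"
proof -
  have perm: "\<pi> permutes {..<n}" using lat by (simp add: lateration_ordering_def)
  have bij: "bij_betw \<pi> {..<n} {..<n}" using perm by (rule permutes_imp_bij)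
  have lt: "\<pi> i < n" if "i < n" for i using perm that by (metis lessThan_iff permutes_in_image)
  have pre: "\<exists>i<n. v = \<pi> i" if "v < n" for v
    using bij that unfolding bij_betw_def by (metis imageE lessThan_iff)
  have diag: "U k k = 1" and below: "k < i \<Longrightarrow> i < n \<Longrightarrow> U i k = 0"
    and nonedge: "i < k \<Longrightarrow> {\<pi> i, \<pi> k} \<notin> E \<Longrightarrow> U i k = - (\<Sum>l=Suc k..<n. U i l * U k l)"
    and ker: "r \<le> d \<Longrightarrow> (\<Sum>i<n. extended_entry d P r (\<pi> i) * U i k) = 0"
    if "d < k" "k < n" for i k r
    using cols[OF that] by (auto simp: stress_column_def)
  have sumpi: "(\<Sum>v<n. f v) = (\<Sum>i<n. f (\<pi> i))" for f :: "nat \<Rightarrow> real"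
    by (rule sum.reindex_bij_betw[OF bij, symmetric])
  have symS: "S\<^sup>T = S"
  proof (rule eq_matI)
    fix v w assume "v < dim_row S" "w < dim_col S"
    then have vw: "v < n" "w < n" using S(1) by auto
    then obtain i j where ij: "i < n" "j < n" "v = \<pi> i" "w = \<pi> j" using pre[of v] pre[of w] by blast
    have "S $$ (w, v) = S $$ (v, w)" unfolding ij(3,4) S(2)[OF ij(1,2)] S(2)[OF ij(2,1)]
      by (simp add: mult.commute)
    then show "S\<^sup>T $$ (v, w) = S $$ (v, w)" using S(1) vw by simp
  qed (use S in auto)
  have stress0: "extended_position_matrix d n P * S = 0\<^sub>m (d + 1) n"
  proof (rule eq_matI)
    fix r w assume "r < dim_row (0\<^sub>m (d + 1) n :: real mat)" "w < dim_col (0\<^sub>m (d + 1) n :: real mat)"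
    then have r: "r \<le> d" and w: "w < n" by auto
    obtain j where j: "j < n" "w = \<pi> j" using pre w by blast
    have "(extended_position_matrix d n P * S) $$ (r, w) = (\<Sum>v<n. extended_entry d P r v * S $$ (v, w))"
      using r w S(1) by (auto simp: extended_position_matrix_def extended_entry_def scalar_prod_def
          atLeast0LessThan intro!: sum.cong)
    also have "\<dots> = (\<Sum>i<n. extended_entry d P r (\<pi> i) * (\<Sum>l=Suc d..<n. U i l * U j l))"
      unfolding sumpi[of "\<lambda>v. extended_entry d P r v * S $$ (v, w)"] using j S(2) by simp
    also have "\<dots> = (\<Sum>l=Suc d..<n. (\<Sum>i<n. extended_entry d P r (\<pi> i) * U i l) * U j l)"
      unfolding sum_distrib_left sum_distrib_right by (subst sum.swap) (simp add: mult.assoc)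
    also have "\<dots> = 0" using ker r by simp
    finally show "(extended_position_matrix d n P * S) $$ (r, w) = 0\<^sub>m (d + 1) n $$ (r, w)"
      using r w by simp
  qed (use S in \<open>auto simp: extended_position_matrix_def\<close>)
  \<comment> \<open>The later of two nonadjacent positions lies outside the clique, so its column was built to
     cancel this entry.\<close>
  have zero_upper: "S $$ (\<pi> i, \<pi> k) = 0" if ik: "i < k" "k < n" and no: "{\<pi> i, \<pi> k} \<notin> E" for i k
  proof -
    have k: "d < k"
    proof (rule ccontr)
      assume "\<not> d < k"
      then have "{\<pi> i, \<pi> k} \<in> E" using lat ik unfolding lateration_ordering_def by auto
      then show False using no by simp
    qed
    have "S $$ (\<pi> i, \<pi> k) = (\<Sum>l=Suc d..<n. U i l * U k l)" using S(2) ik by simp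
    also have "\<dots> = (\<Sum>l=k..<n. U i l * U k l)"
      using k ik below by (intro sum.mono_neutral_right) auto
    also have "\<dots> = U i k * U k k + (\<Sum>l=Suc k..<n. U i l * U k l)"
      using ik by (simp add: sum.atLeast_Suc_lessThan)
    also have "\<dots> = 0" using diag[OF k ik(2)] nonedge[OF k ik(2) ik(1) no] by simp
    finally show ?thesis .
  qed
  have zeros: "S $$ (v, w) = 0" if "v < n" "w < n" "v \<noteq> w" "{v, w} \<notin> E" for v w
  proof -
    obtain i j where ij: "i < n" "j < n" "v = \<pi> i" "w = \<pi> j" using pre[of v] pre[of w] \<open>v < n\<close> \<open>w < n\<close> by blast
    then have "i \<noteq> j" using that(3) by blast
    then consider "i < j" | "j < i" by linarith
    then show ?thesis
    proof cases
      case 1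
      then show ?thesis using zero_upper ij that by simp
    next
      case 2
      then have "S $$ (w, v) = 0" using zero_upper ij that by (simp add: insert_commute)
      then show ?thesis using ij S(2) by (simp add: mult.commute)
    qed
  qed
  have quad: "(\<Sum>i<n. \<Sum>j<n. c i * c j * S $$ (\<pi> i, \<pi> j)) = (\<Sum>l=Suc d..<n. (\<Sum>i<n. c i * U i l)\<^sup>2)" for c
  proof -
    have "(\<Sum>i<n. \<Sum>j<n. c i * c j * S $$ (\<pi> i, \<pi> j)) =
        (\<Sum>i<n. \<Sum>j<n. \<Sum>l=Suc d..<n. (c i * U i l) * (c j * U j l))"
      using S(2) by (intro sum.cong refl) (simp add: sum_distrib_left mult_ac)
    also have "\<dots> = (\<Sum>i<n. \<Sum>l=Suc d..<n. \<Sum>j<n. (c i * U i l) * (c j * U j l))"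
      by (intro sum.cong refl sum.swap)
    also have "\<dots> = (\<Sum>l=Suc d..<n. \<Sum>i<n. \<Sum>j<n. (c i * U i l) * (c j * U j l))"
      by (rule sum.swap)
    also have "\<dots> = (\<Sum>l=Suc d..<n. (\<Sum>i<n. c i * U i l)\<^sup>2)"
      by (simp add: power2_eq_square sum_product)
    finally show ?thesis .
  qed
  have psd: "x \<bullet> (S *\<^sub>v x) \<ge> 0" if x: "x \<in> carrier_vec n" for x
  proof -
    have "x \<bullet> (S *\<^sub>v x) = (\<Sum>v<n. x $ v * (\<Sum>w<n. S $$ (v, w) * x $ w))"
      using x S(1) by (auto simp: scalar_prod_def atLeast0LessThan intro!: sum.cong)
    also have "\<dots> = (\<Sum>v<n. \<Sum>w<n. x $ v * x $ w * S $$ (v, w))"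
      by (simp add: sum_distrib_left mult_ac)
    also have "\<dots> = (\<Sum>i<n. \<Sum>j<n. x $ \<pi> i * x $ \<pi> j * S $$ (\<pi> i, \<pi> j))"
      by (subst sumpi, subst (2) sumpi) (rule refl)
    also have "\<dots> \<ge> 0" unfolding quad[of "\<lambda>i. x $ \<pi> i"] by (intro sum_nonneg) auto
    finally show ?thesis .
  qed
  interpret vec_space "TYPE(real)" n .
  have upper: "rank S \<le> n - d - 1"
  proof -
    define V where "V l v = U (inv_into {..<n} \<pi> v) l" for l v
    have inv: "inv_into {..<n} \<pi> (\<pi> i) = i" if "i < n" for i
      using bij that by (simp add: bij_betw_def inv_into_f_f)
    have "S = mat n n (\<lambda>(i, j). \<Sum>l\<in>{Suc d..<n}. V l i * V l j)"
    proof (rule eq_matI)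
      fix v w assume "v < dim_row (mat n n (\<lambda>(i, j). \<Sum>l\<in>{Suc d..<n}. V l i * V l j))"
        "w < dim_col (mat n n (\<lambda>(i, j). \<Sum>l\<in>{Suc d..<n}. V l i * V l j))"
      then have vw: "v < n" "w < n" by auto
      then obtain i j where "i < n" "j < n" "v = \<pi> i" "w = \<pi> j" using pre[of v] pre[of w] by blast
      then show "S $$ (v, w) = mat n n (\<lambda>(i, j). \<Sum>l\<in>{Suc d..<n}. V l i * V l j) $$ (v, w)"
        using S(2) vw by (simp add: V_def inv)
    qed (use S in auto)
    then show ?thesis
      using rank_le_sum_of_outer_products[of "{Suc d..<n}" V V] by simp
  qed
  have lower: "n - d - 1 \<le> rank S"
  proof (rule rank_ge_independent_columns[OF S(1), where J = "\<lambda>t. \<pi> (t + Suc d)"])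
    show "\<pi> (t + Suc d) < n" if "t < n - d - 1" for t using lt that by simp
    fix c :: "nat \<Rightarrow> real"
    assume c: "\<forall>i<n. (\<Sum>t<n - d - 1. S $$ (i, \<pi> (t + Suc d)) * c t) = 0"
    \<comment> \<open>A relation between the selected columns, extended by zero to all positions.\<close>
    define c' where "c' i = (if d < i then c (i - Suc d) else 0)" for i
    have shift: "(\<Sum>j<n. f j * c' j) = (\<Sum>t<n - d - 1. f (t + Suc d) * c t)" for f
    proof -
      have "(\<Sum>j<n. f j * c' j) = (\<Sum>j\<in>{Suc d..<n}. f j * c' j)"
        by (intro sum.mono_neutral_right) (auto simp: c'_def)
      also have "\<dots> = (\<Sum>t<n - d - 1. f (t + Suc d) * c t)"
        by (rule sum.reindex_bij_witness[of _ "\<lambda>t. t + Suc d" "\<lambda>j. j - Suc d"])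
           (auto simp: c'_def)
      finally show ?thesis .
    qed
    have "(\<Sum>i<n. \<Sum>j<n. c' i * c' j * S $$ (\<pi> i, \<pi> j)) = 0"
    proof (rule sum.neutral, rule ballI)
      fix i assume i: "i \<in> {..<n}"
      have "(\<Sum>j<n. c' i * c' j * S $$ (\<pi> i, \<pi> j)) = c' i * (\<Sum>j<n. S $$ (\<pi> i, \<pi> j) * c' j)"
        by (simp add: sum_distrib_left mult_ac)
      also have "\<dots> = 0" using c lt i by (simp add: shift)
      finally show "(\<Sum>j<n. c' i * c' j * S $$ (\<pi> i, \<pi> j)) = 0" .
    qed
    then have "\<forall>l\<in>{Suc d..<n}. (\<Sum>i<n. c' i * U i l)\<^sup>2 = 0"
      unfolding quad by (subst (asm) sum_nonneg_eq_0_iff) auto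
    then have full: "(\<Sum>i<n. c' i * U i l) = 0" if "Suc d \<le> l" "l < n" for l using that by simp
    have "(\<Sum>i=Suc d..<n. c' i * U i l) = 0" if "Suc d \<le> l" "l < n" for l
    proof -
      have "(\<Sum>i<n. c' i * U i l) = (\<Sum>i=Suc d..<n. c' i * U i l)"
        by (intro sum.mono_neutral_right) (auto simp: c'_def)
      then show ?thesis using full[OF that] by simp
    qed
    then have "c' j = 0" if "Suc d \<le> j" "j < n" for j
      using upper_triangular_kernel_trivial[of "Suc d" n U c' j] diag below that by force
    then have "c' (t + Suc d) = 0" if "t < n - d - 1" for t using that by simp
    then show "\<forall>t<n - d - 1. c t = 0" by (simp add: c'_def)
  qed
  show ?thesis
    using S(1) symS stress0 zeros psd upper lower
    by (auto simp: stress_matrix_def positive_semidefinite_def)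
qed

text \<open>
  A kernel vector of the extended columns at the points \<open>f a\<close> is an affine dependence of these points:
  the last row of the extended matrix gives the vanishing of the sum of the coefficients.
\<close>

lemma general_position_rows_independent:
  assumes gp: "general_position d n P" and inj: "inj_on f {..<d + 1}" and f: "\<And>a. a < d + 1 \<Longrightarrow> f a < n"
  shows "rows_independent (d + 1) (\<lambda>r a. extended_entry d P r (f a))"
proof (rule rows_independent_if_columns_independent, rule ccontr)
  fix c :: "nat \<Rightarrow> real"
  assume c: "\<forall>r<d + 1. (\<Sum>a<d + 1. extended_entry d P r (f a) * c a) = 0" and "\<not> (\<forall>a<d + 1. c a = 0)"
  then obtain a0 where a0: "a0 < d + 1" "c a0 \<noteq> 0" by blast
  let ?I = "f ` {..<d + 1}" and ?g = "inv_into {..<d + 1} f"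
  have re: "(\<Sum>i\<in>?I. h i) = (\<Sum>a<d + 1. h (f a))" for h :: "nat \<Rightarrow> real"
    by (simp only: sum.reindex[OF inj] o_def)
  have g: "?g (f a) = a" if "a < d + 1" for a using inj that by (simp add: inv_into_f_f)
  have "columns_affinely_dependent d P ?I"
    unfolding columns_affinely_dependent_def
  proof (intro exI[of _ "\<lambda>i. c (?g i)"] conjI allI impI)
    show "\<exists>i\<in>?I. c (?g i) \<noteq> 0" using a0 g by (intro bexI[of _ "f a0"]) auto
    show "(\<Sum>i\<in>?I. c (?g i)) = 0"
      unfolding re using g c[rule_format, of d] by (simp add: extended_entry_def del: sum.lessThan_Suc)
    fix r assume "r < d"
    then show "(\<Sum>i\<in>?I. c (?g i) * P $$ (r, i)) = 0"
      unfolding re using g c[rule_format, of r]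
      by (simp add: extended_entry_def mult.commute del: sum.lessThan_Suc)
  qed
  moreover have "card ?I = d + 1" using card_image[OF inj] by simp
  moreover have "?I \<subseteq> {..<n}" using f by auto
  ultimately show False using gp unfolding general_position_def by blast
qed

section \<open>Time-bounded correctness of programs\<close>

text \<open>
  Total correctness with a bound on the number of steps. The postcondition is only required for one
  terminating execution, as in the claim about the program.
\<close>

definition halts_within :: "com \<Rightarrow> state \<Rightarrow> nat \<Rightarrow> (state \<Rightarrow> bool) \<Rightarrow> bool" where
  "halts_within c s T Q \<longleftrightarrow> (\<exists>t s'. exec c s t s' \<and> t \<le> T \<and> Q s')"

text \<open>
  The memory that a program may write is read off its syntax. Everything else keeps its value, so
  that invariants need to speak only of what a loop changes.
\<close>

primrec written_iregs :: "com \<Rightarrow> nat set" where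
  "written_iregs Skip = {}"
| "written_iregs (IAssign x e) = {x}"
| "written_iregs (IStore a e f g) = {}"
| "written_iregs (RStore a e f g) = {}"
| "written_iregs (Seq c c') = written_iregs c \<union> written_iregs c'"
| "written_iregs (Cond b c c') = written_iregs c \<union> written_iregs c'"
| "written_iregs (While b c) = written_iregs c"

primrec written_iarrs :: "com \<Rightarrow> nat set" where
  "written_iarrs Skip = {}"
| "written_iarrs (IAssign x e) = {}"
| "written_iarrs (IStore a e f g) = {a}"
| "written_iarrs (RStore a e f g) = {}"
| "written_iarrs (Seq c c') = written_iarrs c \<union> written_iarrs c'"
| "written_iarrs (Cond b c c') = written_iarrs c \<union> written_iarrs c'"
| "written_iarrs (While b c) = written_iarrs c"

primrec written_rarrs :: "com \<Rightarrow> nat set" where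
  "written_rarrs Skip = {}"
| "written_rarrs (IAssign x e) = {}"
| "written_rarrs (IStore a e f g) = {}"
| "written_rarrs (RStore a e f g) = {a}"
| "written_rarrs (Seq c c') = written_rarrs c \<union> written_rarrs c'"
| "written_rarrs (Cond b c c') = written_rarrs c \<union> written_rarrs c'"
| "written_rarrs (While b c) = written_rarrs c"

definition unchanged :: "com \<Rightarrow> state \<Rightarrow> state \<Rightarrow> bool" where
  "unchanged c s s' \<longleftrightarrow>
     (\<forall>x. x \<notin> written_iregs c \<longrightarrow> ireg s' x = ireg s x) \<and>
     (\<forall>a. a \<notin> written_iarrs c \<longrightarrow> iarr s' a = iarr s a) \<and>
     (\<forall>a. a \<notin> written_rarrs c \<longrightarrow> rarr s' a = rarr s a)"

lemma exec_unchanged: "exec c s t s' \<Longrightarrow> unchanged c s s'"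
  by (induction rule: exec.induct) (auto simp: unchanged_def)

lemma halts_conseq:
  assumes "halts_within c s T Q" "T \<le> T'" "\<And>s'. unchanged c s s' \<Longrightarrow> Q s' \<Longrightarrow> Q' s'"
  shows "halts_within c s T' Q'"
  using assms exec_unchanged unfolding halts_within_def by (meson order.trans)

lemma halts_Skip: "Q s \<Longrightarrow> halts_within Skip s T Q"
  unfolding halts_within_def using exec.Skip by blast

lemma halts_IAssign:
  "Q (s\<lparr>ireg := (ireg s)(x := ival e s)\<rparr>) \<Longrightarrow> 1 + icost e \<le> T \<Longrightarrow> halts_within (IAssign x e) s T Q"
  unfolding halts_within_def using exec.IAssign by blast

lemma halts_IStore:
  "Q (s\<lparr>iarr := (iarr s)(a := (iarr s a)(ival e s := (iarr s a (ival e s))(ival f s := ival g s)))\<rparr>) \<Longrightarrow>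
   1 + icost e + icost f + icost g \<le> T \<Longrightarrow> halts_within (IStore a e f g) s T Q"
  unfolding halts_within_def using exec.IStore by blast

lemma halts_RStore:
  "rdefined g s \<Longrightarrow>
   Q (s\<lparr>rarr := (rarr s)(a := (rarr s a)(ival e s := (rarr s a (ival e s))(ival f s := rval g s)))\<rparr>) \<Longrightarrow>
   1 + icost e + icost f + rcost g \<le> T \<Longrightarrow> halts_within (RStore a e f g) s T Q"
  unfolding halts_within_def using exec.RStore by blast

lemma halts_Seq:
  assumes "halts_within c s T R"
    and "\<And>s'. unchanged c s s' \<Longrightarrow> R s' \<Longrightarrow> halts_within c' s' T' Q"
    and "T + T' \<le> U"
  shows "halts_within (Seq c c') s U Q"
proof -
  obtain t s' where 1: "exec c s t s'" "t \<le> T" "R s'" using assms(1) by (auto simp: halts_within_def)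
  obtain t' s'' where 2: "exec c' s' t' s''" "t' \<le> T'" "Q s''"
    using assms(2)[OF exec_unchanged[OF 1(1)] 1(3)] by (auto simp: halts_within_def)
  show ?thesis unfolding halts_within_def using exec.Seq[OF 1(1) 2(1)] 1 2 assms(3)
    by (meson add_mono order.trans)
qed

lemma halts_Cond:
  assumes "bdefined b s"
    and "bval b s \<Longrightarrow> halts_within c s T Q"
    and "\<not> bval b s \<Longrightarrow> halts_within c' s T Q"
    and "1 + bcost b + T \<le> T'"
  shows "halts_within (Cond b c c') s T' Q"
proof (cases "bval b s")
  case True
  then obtain t s' where "exec c s t s'" "t \<le> T" "Q s'" using assms(2) by (auto simp: halts_within_def)
  then show ?thesis unfolding halts_within_def using exec.CondTrue[OF assms(1) True] assms(4)
    by (meson add_left_mono order.trans)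
next
  case False
  then obtain t s' where "exec c' s t s'" "t \<le> T" "Q s'" using assms(3) by (auto simp: halts_within_def)
  then show ?thesis unfolding halts_within_def using exec.CondFalse[OF assms(1) False] assms(4)
    by (meson add_left_mono order.trans)
qed

text \<open>
  The bound \<open>hi\<close> is evaluated anew at every test, so that the loop counts up to a fixed bound only
  if its body preserves the value of \<open>hi\<close>.
\<close>

definition For :: "nat \<Rightarrow> iexp \<Rightarrow> iexp \<Rightarrow> com \<Rightarrow> com" where
  "For x lo hi c = Seq (IAssign x lo)
     (While (ILess (IReg x) hi) (Seq c (IAssign x (IAdd (IReg x) (IConst 1)))))"

lemma written_For [simp]:
  "written_iregs (For x lo hi c) = insert x (written_iregs c)"
  "written_iarrs (For x lo hi c) = written_iarrs c"
  "written_rarrs (For x lo hi c) = written_rarrs c"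
  by (auto simp: For_def)

text \<open>
  \<open>I i\<close> is the invariant at the test with counter \<open>i\<close>. The loop ends with the counter at \<open>max l h\<close>,
  which also covers an empty range. One round costs, besides the body, \<open>icost hi + 3\<close> steps for the
  test and \<open>4\<close> for the increment. The premises on \<open>hi\<close>, on
  a round and on the exit may use that memory which the loop does not write is as in the beginning.
\<close>

lemma halts_For:
  assumes x: "x \<notin> written_iregs c"
    and lo: "ival lo s = l"
    and hi: "\<And>s'. unchanged (For x lo hi c) s s' \<Longrightarrow> ival hi s' = h"
    and init: "I l (s\<lparr>ireg := (ireg s)(x := l)\<rparr>)"
    and step: "\<And>i s'. l \<le> i \<Longrightarrow> i < h \<Longrightarrow> unchanged (For x lo hi c) s s' \<Longrightarrow> ireg s' x = i \<Longrightarrow> I i s' \<Longrightarrow>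
        halts_within c s' T (\<lambda>s''. I (Suc i) (s''\<lparr>ireg := (ireg s'')(x := Suc i)\<rparr>))"
    and exit: "\<And>s'. unchanged (For x lo hi c) s s' \<Longrightarrow> I (max l h) s' \<Longrightarrow> Q s'"
    and time: "icost lo + icost hi + 4 + (h - l) * (T + icost hi + 7) \<le> T'"
  shows "halts_within (For x lo hi c) s T' Q"
proof -
  let ?w = "While (ILess (IReg x) hi) (Seq c (IAssign x (IAdd (IReg x) (IConst 1))))"
  have loop: "\<exists>t s''. exec ?w s' t s'' \<and> t \<le> icost hi + 3 + (h - i) * (T + icost hi + 7) \<and> Q s''"
    if "l \<le> i" "i \<le> max l h" "unchanged (For x lo hi c) s s'" "ireg s' x = i" "I i s'" for i s'
    using that
  proof (induction "h - i" arbitrary: i s')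
    case 0
    then have "i = max l h" by auto
    then have "Q s'" using exit 0 by simp
    moreover have "exec ?w s' (1 + bcost (ILess (IReg x) hi)) s'"
      using 0 hi by (intro exec.WhileFalse) auto
    ultimately show ?case using 0 by (intro exI[of _ "1 + bcost (ILess (IReg x) hi)"] exI[of _ s']) simp
  next
    case (Suc m)
    have i: "i < h" using Suc by simp
    obtain t s1 where s1: "exec c s' t s1" "t \<le> T" "I (Suc i) (s1\<lparr>ireg := (ireg s1)(x := Suc i)\<rparr>)"
      using step[OF Suc.prems(1) i Suc.prems(3-5)] by (auto simp: halts_within_def)
    let ?s2 = "s1\<lparr>ireg := (ireg s1)(x := Suc i)\<rparr>"
    have u1: "unchanged c s' s1" using s1(1) by (rule exec_unchanged)
    have "ireg s1 x = i" using u1 x Suc.prems by (simp add: unchanged_def)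
    then have inc: "exec (IAssign x (IAdd (IReg x) (IConst 1))) s1 4 ?s2"
      using exec.IAssign[of x "IAdd (IReg x) (IConst 1)" s1] by (simp add: numeral_eq_Suc)
    have u2: "unchanged (For x lo hi c) s ?s2"
      using Suc.prems(3) u1 by (auto simp: unchanged_def)
    obtain t2 s3 where s3: "exec ?w ?s2 t2 s3" "t2 \<le> icost hi + 3 + (h - Suc i) * (T + icost hi + 7)" "Q s3"
    proof -
      have "m = h - Suc i" "l \<le> Suc i" "Suc i \<le> max l h" "ireg ?s2 x = Suc i"
        using Suc.hyps(2) Suc.prems(1) i by auto
      then show thesis using Suc.hyps(1)[OF _ _ _ u2 _ s1(3)] that by blast
    qed
    have "exec ?w s' (1 + bcost (ILess (IReg x) hi) + (t + 4) + t2) s3"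
      using Suc.prems i hi s1 s3 inc by (intro exec.WhileTrue[OF _ _ exec.Seq]) auto
    moreover have "h - i = Suc (h - Suc i)" using i by simp
    ultimately show ?case using s1(2) s3 
      by (intro exI[of _ "1 + bcost (ILess (IReg x) hi) + (t + 4) + t2"] exI[of _ s3]) simp
  qed
  let ?s0 = "s\<lparr>ireg := (ireg s)(x := l)\<rparr>"
  have "unchanged (For x lo hi c) s ?s0" by (simp add: unchanged_def)
  then obtain t s'' where "t \<le> icost hi + 3 + (h - l) * (T + icost hi + 7)" "Q s''"
    and loop: "exec ?w ?s0 t s''"
    using loop[of l ?s0] init by auto
  note loop
  moreover have "exec (IAssign x lo) s (1 + icost lo) ?s0"
    using exec.IAssign[of x lo s] lo by simp
  ultimately have "exec (For x lo hi c) s (1 + icost lo + t) s''"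
    unfolding For_def by (rule exec.Seq[rotated])
  then show ?thesis
    unfolding halts_within_def using time \<open>Q s''\<close>
      \<open>t \<le> icost hi + 3 + (h - l) * (T + icost hi + 7)\<close>
    by (intro exI[of _ "1 + icost lo + t"] exI[of _ s'']) auto
qed

definition Accumulate :: "nat \<Rightarrow> iexp \<Rightarrow> iexp \<Rightarrow> nat \<Rightarrow> iexp \<Rightarrow> iexp \<Rightarrow> rexp \<Rightarrow> com" where
  "Accumulate x lo hi a e f g =
     Seq (RStore a e f (RConst 0)) (For x lo hi (RStore a e f (RAdd (RAt a e f) g)))"

lemma written_Accumulate [simp]:
  "written_iregs (Accumulate x lo hi a e f g) = {x}"
  "written_iarrs (Accumulate x lo hi a e f g) = {}"
  "written_rarrs (Accumulate x lo hi a e f g) = {a}"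
  by (auto simp: Accumulate_def)

text \<open>
  A summand may read the array in which the sum grows, at other entries than the growing one. The
  premise on the summands therefore lets the value \<open>v\<close> of that entry be arbitrary.
\<close>

lemma halts_Accumulate:
  assumes const: "\<And>s'. unchanged (Accumulate x lo hi a e f g) s s' \<Longrightarrow>
        ival e s' = i \<and> ival f s' = j \<and> ival hi s' = h"
    and lo: "\<And>s'. unchanged (RStore a e f (RConst 0)) s s' \<Longrightarrow> ival lo s' = l"
    and summand: "\<And>s' m v. unchanged (Accumulate x lo hi a e f g) s s' \<Longrightarrow> ireg s' x = m \<Longrightarrow>
        l \<le> m \<Longrightarrow> m < h \<Longrightarrow> rarr s' a = (rarr s a)(i := (rarr s a i)(j := v)) \<Longrightarrow>
        rdefined g s' \<and> rval g s' = G m"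
    and time: "icost lo + icost hi + icost e + icost f + 6 +
        (h - l) * (2 * icost e + 2 * icost f + rcost g + icost hi + 10) \<le> T"
  shows "halts_within (Accumulate x lo hi a e f g) s T
    (\<lambda>s'. rarr s' a = (rarr s a)(i := (rarr s a i)(j := (\<Sum>m=l..<h. G m))))"
proof -
  let ?A = "Accumulate x lo hi a e f g" and ?B = "RStore a e f (RAdd (RAt a e f) g)"
  let ?U = "\<lambda>v. (rarr s a)(i := (rarr s a i)(j := v))"
  have s: "ival e s = i" "ival f s = j" using const[of s] by (auto simp: unchanged_def)
  show ?thesis
    unfolding Accumulate_def
  proof (rule halts_Seq)
    show "halts_within (RStore a e f (RConst 0)) s (2 + icost e + icost f) (\<lambda>s'. rarr s' a = ?U 0)"
      by (rule halts_RStore) (auto simp: s)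
    show "2 + icost e + icost f + (icost lo + icost hi + 4 +
        (h - l) * ((2 * icost e + 2 * icost f + rcost g + 3) + icost hi + 7)) \<le> T"
      using time by (simp add: algebra_simps)
    fix s1 assume u1: "unchanged (RStore a e f (RConst 0)) s s1" and U1: "rarr s1 a = ?U 0"
    have uA: "unchanged ?A s s'" if "unchanged (For x lo hi ?B) s1 s'" for s'
      using u1 that by (auto simp: unchanged_def)
    show "halts_within (For x lo hi ?B) s1 (icost lo + icost hi + 4 +
        (h - l) * ((2 * icost e + 2 * icost f + rcost g + 3) + icost hi + 7))
        (\<lambda>s'. rarr s' a = ?U (\<Sum>m=l..<h. G m))"
    proof (rule halts_For[where I = "\<lambda>m s'. rarr s' a = ?U (\<Sum>m=l..<m. G m)" and l = l and h = h
          and T = "2 * icost e + 2 * icost f + rcost g + 3"])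
      show "ival lo s1 = l" using lo u1 by simp
      show "ival hi s' = h" if "unchanged (For x lo hi ?B) s1 s'" for s' using const[OF uA[OF that]] by simp
      fix m s' assume m: "l \<le> m" "m < h" and u: "unchanged (For x lo hi ?B) s1 s'"
        and x: "ireg s' x = m" and I: "rarr s' a = ?U (\<Sum>m=l..<m. G m)"
      show "halts_within ?B s' (2 * icost e + 2 * icost f + rcost g + 3)
          (\<lambda>s''. rarr (s''\<lparr>ireg := (ireg s'')(x := Suc m)\<rparr>) a = ?U (\<Sum>m=l..<Suc m. G m))"
        using summand[OF uA[OF u] x m I] const[OF uA[OF u]] m
        by (intro halts_RStore) (auto simp: I)
    next
      show "rarr s' a = ?U (\<Sum>m=l..<h. G m)" if "rarr s' a = ?U (\<Sum>m=l..<max l h. G m)" for s'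
        using that by (cases "l \<le> h") (auto simp: max_def)
    qed (use U1 in auto)
  qed
qed

section \<open>The program\<close>

lemma holds_input_unchanged:
  assumes "holds_input s d n E P \<pi>" "unchanged c s s'" 
    "0 \<notin> written_iregs c" "1 \<notin> written_iregs c" "0 \<notin> written_iarrs c" "1 \<notin> written_iarrs c"
    "0 \<notin> written_rarrs c"
  shows "holds_input s' d n E P \<pi>"
  using assms by (simp add: holds_input_def unchanged_def)

text \<open>
  Registers, index arrays and real arrays are addressed by numbers. The first few of them are fixed by
  the input and output conventions, the others are scratch memory.
\<close>

abbreviation (input) n_reg :: nat where "n_reg \<equiv> 0"
abbreviation (input) d_reg :: nat where "d_reg \<equiv> 1"
abbreviation (input) k_reg :: nat where "k_reg \<equiv> 2"
abbreviation (input) i_reg :: nat where "i_reg \<equiv> 3"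
abbreviation (input) l_reg :: nat where "l_reg \<equiv> 4"
abbreviation (input) count_reg :: nat where "count_reg \<equiv> 5"
abbreviation (input) r_reg :: nat where "r_reg \<equiv> 6"
abbreviation (input) a_reg :: nat where "a_reg \<equiv> 7"
abbreviation (input) b_reg :: nat where "b_reg \<equiv> 8"
abbreviation (input) m_reg :: nat where "m_reg \<equiv> 9"

abbreviation (input) order_arr :: nat where "order_arr \<equiv> 0"
abbreviation (input) adjacency_arr :: nat where "adjacency_arr \<equiv> 1"
abbreviation (input) nbr_arr :: nat where "nbr_arr \<equiv> 2"

abbreviation (input) point_arr :: nat where "point_arr \<equiv> 0"
abbreviation (input) stress_arr :: nat where "stress_arr \<equiv> 1"
abbreviation (input) column_arr :: nat where "column_arr \<equiv> 2"
abbreviation (input) projector_arr :: nat where "projector_arr \<equiv> 3"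
abbreviation (input) direction_arr :: nat where "direction_arr \<equiv> 4"
abbreviation (input) extended_arr :: nat where "extended_arr \<equiv> 5"
abbreviation (input) scalar_arr :: nat where "scalar_arr \<equiv> 6"

abbreviation (input) zero_idx :: iexp where "zero_idx \<equiv> IConst 0"
abbreviation (input) D_exp :: iexp where "D_exp \<equiv> IAdd (IReg d_reg) (IConst 1)"
abbreviation (input) vertex_at :: "nat \<Rightarrow> iexp" where "vertex_at x \<equiv> IAt order_arr (IReg x) zero_idx"
abbreviation (input) nbr_at :: "nat \<Rightarrow> iexp" where "nbr_at x \<equiv> IAt nbr_arr (IReg x) zero_idx"
abbreviation (input) pivot :: rexp where "pivot \<equiv> RAt scalar_arr (IConst 0) (IConst 0)"
abbreviation (input) residual :: rexp where "residual \<equiv> RAt scalar_arr (IConst 0) (IConst 1)"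

text \<open>
  The extended position matrix is stored with its columns permuted into the lateration ordering.
  All later steps work with positions instead of vertices.
\<close>

definition load_points :: com where
  "load_points =
     For r_reg zero_idx D_exp (For i_reg zero_idx (IReg n_reg)
       (Cond (ILess (IReg r_reg) (IReg d_reg))
         (RStore extended_arr (IReg r_reg) (IReg i_reg) (RAt point_arr (IReg r_reg) (vertex_at i_reg)))
         (RStore extended_arr (IReg r_reg) (IReg i_reg) (RConst 1))))"

text \<open>
  Fills column \<open>k\<close> at the entries that are forced: the diagonal, the zeros below it, and the
  nonneighbours before \<open>k\<close>. The neighbours before \<open>k\<close> are collected in a list and get \<open>0\<close> as a
  starting value, which the solver corrects.
\<close>

definition prescribe_column :: com where
  "prescribe_column =
     Seq (IAssign count_reg (IConst 0))
     (Seq (For i_reg zero_idx (IReg n_reg)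
       (Seq (RStore column_arr (IReg i_reg) (IReg k_reg) (RConst 0))
         (Cond (ILess (IReg i_reg) (IReg k_reg))
           (Cond (IEq (IAt adjacency_arr (vertex_at i_reg) (vertex_at k_reg)) (IConst 1))
             (Seq (IStore nbr_arr (IReg count_reg) zero_idx (IReg i_reg))
                  (IAssign count_reg (IAdd (IReg count_reg) (IConst 1))))
             (Accumulate l_reg (IAdd (IReg k_reg) (IConst 1)) (IReg n_reg)
                column_arr (IReg i_reg) (IReg k_reg)
                (RSub (RConst 0) (RMul (RAt column_arr (IReg i_reg) (IReg l_reg))
                                       (RAt column_arr (IReg k_reg) (IReg l_reg))))))
           Skip)))
     (RStore column_arr (IReg k_reg) (IReg k_reg) (RConst 1)))"

definition init_projector :: com where
  "init_projector =
     For a_reg zero_idx D_exp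
       (Seq (For b_reg zero_idx D_exp (RStore projector_arr (IReg a_reg) (IReg b_reg) (RConst 0)))
            (RStore projector_arr (IReg a_reg) (IReg a_reg) (RConst 1)))"

definition compute_direction :: com where
  "compute_direction =
     For a_reg zero_idx D_exp (Accumulate b_reg zero_idx D_exp direction_arr (IReg a_reg) zero_idx
       (RMul (RAt projector_arr (IReg a_reg) (IReg b_reg)) (RAt extended_arr (IReg r_reg) (nbr_at b_reg))))"

definition compute_pivot :: com where
  "compute_pivot =
     Accumulate a_reg zero_idx D_exp scalar_arr (IConst 0) (IConst 0)
       (RMul (RAt direction_arr (IReg a_reg) zero_idx) (RAt extended_arr (IReg r_reg) (nbr_at a_reg)))"

definition compute_residual :: com where
  "compute_residual =
     Accumulate i_reg zero_idx (IReg n_reg) scalar_arr (IConst 0) (IConst 1)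
       (RMul (RAt extended_arr (IReg r_reg) (IReg i_reg)) (RAt column_arr (IReg i_reg) (IReg k_reg)))"

definition correct_column :: com where
  "correct_column =
     For a_reg zero_idx D_exp (RStore column_arr (nbr_at a_reg) (IReg k_reg)
       (RSub (RAt column_arr (nbr_at a_reg) (IReg k_reg))
             (RMul (RDiv residual pivot) (RAt direction_arr (IReg a_reg) zero_idx))))"

definition update_projector :: com where
  "update_projector =
     For a_reg zero_idx D_exp (For b_reg zero_idx D_exp
       (RStore projector_arr (IReg a_reg) (IReg b_reg)
         (RSub (RAt projector_arr (IReg a_reg) (IReg b_reg))
               (RDiv (RMul (RAt direction_arr (IReg a_reg) zero_idx) (RAt direction_arr (IReg b_reg) zero_idx))
                     pivot))))"

text \<open>
  One step of the projection method on the neighbour entries of column \<open>k\<close>. Only the \<open>d + 1\<close> listed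
  positions take part, so that the step costs \<open>O(n + d\<^sup>2)\<close>; the residual is formed over the whole
  column, which accounts for the prescribed entries.
\<close>

definition solve_row :: com where
  "solve_row =
     Seq compute_direction (Seq compute_pivot (Seq compute_residual
       (Seq correct_column update_projector)))"

definition solve_column :: com where
  "solve_column = Seq init_projector (For r_reg zero_idx D_exp solve_row)"

text \<open>
  The loop counts upwards and handles column \<open>k = n - 1 - m\<close>, because the entries of a column are
  prescribed by the columns after it.
\<close>

definition compute_columns :: com where
  "compute_columns =
     For m_reg zero_idx (ISub (IReg n_reg) D_exp)
       (Seq (IAssign k_reg (ISub (ISub (IReg n_reg) (IConst 1)) (IReg m_reg)))
       (Seq prescribe_column solve_column))"

definition multiply_columns :: com where
  "multiply_columns =
     For i_reg zero_idx (IReg n_reg) (For b_reg zero_idx (IReg n_reg)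
       (Accumulate l_reg D_exp (IReg n_reg) stress_arr (vertex_at i_reg) (vertex_at b_reg)
         (RMul (RAt column_arr (IReg i_reg) (IReg l_reg)) (RAt column_arr (IReg b_reg) (IReg l_reg)))))"

definition stress_program :: com where
  "stress_program = Seq load_points (Seq compute_columns multiply_columns)"

lemma written_blocks [simp]:
  "written_iregs load_points = {r_reg, i_reg}"
  "written_iarrs load_points = {}"
  "written_rarrs load_points = {extended_arr}"
  "written_iregs prescribe_column = {count_reg, i_reg, l_reg}"
  "written_iarrs prescribe_column = {nbr_arr}"
  "written_rarrs prescribe_column = {column_arr}"
  "written_iregs init_projector = {a_reg, b_reg}"
  "written_iarrs init_projector = {}"
  "written_rarrs init_projector = {projector_arr}"
  "written_iregs compute_direction = {a_reg, b_reg}"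
  "written_iarrs compute_direction = {}"
  "written_rarrs compute_direction = {direction_arr}"
  "written_iregs compute_pivot = {a_reg}"
  "written_iarrs compute_pivot = {}"
  "written_rarrs compute_pivot = {scalar_arr}"
  "written_iregs compute_residual = {i_reg}"
  "written_iarrs compute_residual = {}"
  "written_rarrs compute_residual = {scalar_arr}"
  "written_iregs correct_column = {a_reg}"
  "written_iarrs correct_column = {}"
  "written_rarrs correct_column = {column_arr}"
  "written_iregs update_projector = {a_reg, b_reg}"
  "written_iarrs update_projector = {}"
  "written_rarrs update_projector = {projector_arr}"
  by (auto simp: load_points_def prescribe_column_def init_projector_def compute_direction_def
      compute_pivot_def compute_residual_def correct_column_def update_projector_def)

lemma written_composites [simp]:
  "written_iregs solve_row = {a_reg, b_reg, i_reg}"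
  "written_iarrs solve_row = {}"
  "written_rarrs solve_row = {direction_arr, scalar_arr, column_arr, projector_arr}"
  "written_iregs solve_column = {a_reg, b_reg, i_reg, r_reg}"
  "written_iarrs solve_column = {}"
  "written_rarrs solve_column = {direction_arr, scalar_arr, column_arr, projector_arr}"
  by (auto simp: solve_row_def solve_column_def)

lemma written_compute_columns [simp]:
  "written_iregs compute_columns = {m_reg, k_reg, count_reg, i_reg, l_reg, a_reg, b_reg, r_reg}"
  "written_iarrs compute_columns = {nbr_arr}"
  "written_rarrs compute_columns = {direction_arr, scalar_arr, column_arr, projector_arr}"
  by (auto simp: compute_columns_def)

lemma halts_compute_direction:
  assumes d: "ireg s d_reg = d"
  shows "halts_within compute_direction s (8 + (d + 1) * (22 + 26 * (d + 1)))
     (\<lambda>s'. \<forall>a<d + 1. rarr s' direction_arr a 0 =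
        (\<Sum>b<d + 1. rarr s projector_arr a b * rarr s extended_arr (ireg s r_reg) (iarr s nbr_arr b 0)))"
  (is "halts_within _ _ _ (\<lambda>s'. \<forall>a<d + 1. _ = ?p a)")
  unfolding compute_direction_def
proof (rule halts_For[where I = "\<lambda>a s'. \<forall>a'<a. rarr s' direction_arr a' 0 = ?p a'" and l = 0
      and h = "d + 1" and T = "12 + (d + 1) * 26"], goal_cases)
  case (5 a s')
  note u = 5(3)[unfolded unchanged_def, simplified]
  show ?case
    by (rule halts_conseq, rule halts_Accumulate[where i = a and j = 0 and l = 0 and h = "d + 1"
          and G = "\<lambda>b. rarr s projector_arr a b * rarr s extended_arr (ireg s r_reg) (iarr s nbr_arr b 0)"])
       (use 5 d u in \<open>auto simp: unchanged_def less_Suc_eq atLeast0LessThan\<close>)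
qed (use d in \<open>auto simp: unchanged_def\<close>)

section \<open>Correctness of the building blocks\<close>

lemma halts_compute_pivot:
  assumes d: "ireg s d_reg = d"
  shows "halts_within compute_pivot s (12 + (d + 1) * 26)
     (\<lambda>s'. rarr s' scalar_arr 0 0 =
        (\<Sum>a<d + 1. rarr s direction_arr a 0 * rarr s extended_arr (ireg s r_reg) (iarr s nbr_arr a 0)))"
  unfolding compute_pivot_def
  by (rule halts_conseq, rule halts_Accumulate[where i = 0 and j = 0 and l = 0 and h = "d + 1"
        and G = "\<lambda>a. rarr s direction_arr a 0 * rarr s extended_arr (ireg s r_reg) (iarr s nbr_arr a 0)"])
     (use d in \<open>auto simp: unchanged_def atLeast0LessThan\<close>)

lemma halts_compute_residual:
  assumes n: "ireg s n_reg = n"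
  shows "halts_within compute_residual s (10 + n * 22)
     (\<lambda>s'. rarr s' scalar_arr 0 0 = rarr s scalar_arr 0 0 \<and>
        rarr s' scalar_arr 0 1 =
          (\<Sum>i<n. rarr s extended_arr (ireg s r_reg) i * rarr s column_arr i (ireg s k_reg)))"
  unfolding compute_residual_def
  by (rule halts_conseq, rule halts_Accumulate[where i = 0 and j = 1 and l = 0 and h = n
        and G = "\<lambda>i. rarr s extended_arr (ireg s r_reg) i * rarr s column_arr i (ireg s k_reg)"])
     (use n in \<open>auto simp: unchanged_def atLeast0LessThan\<close>)

text \<open>
  Injectivity of the neighbour list matters: a repeated position would be corrected twice.
\<close>

lemma halts_correct_column:
  fixes s defines "nb \<equiv> \<lambda>a. iarr s nbr_arr a 0" and "k \<equiv> ireg s k_reg"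
  assumes d: "ireg s d_reg = d" and w: "rarr s scalar_arr 0 0 \<noteq> 0" and bij: "bij_betw nb {..<d + 1} N"
  shows "halts_within correct_column s (8 + (d + 1) * 32)
     (\<lambda>s'. (\<forall>a<d + 1. rarr s' column_arr (nb a) k = rarr s column_arr (nb a) k -
             rarr s scalar_arr 0 1 / rarr s scalar_arr 0 0 * rarr s direction_arr a 0) \<and>
           (\<forall>i l. l \<noteq> k \<or> i \<notin> N \<longrightarrow> rarr s' column_arr i l = rarr s column_arr i l))"
  (is "halts_within _ _ _ (\<lambda>s'. (\<forall>a<d + 1. _ s' a = ?new a) \<and> ?rest s')")
  unfolding correct_column_def
proof (rule halts_For[where I = "\<lambda>a s'. (\<forall>a'<d + 1. rarr s' column_arr (nb a') k =
        (if a' < a then ?new a' else rarr s column_arr (nb a') k)) \<and> ?rest s'" and l = 0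
      and h = "d + 1" and T = 22], goal_cases)
  case (5 a s')
  note u = 5(3)[unfolded unchanged_def, simplified]
  have nb': "iarr s nbr_arr a 0 = nb a" "ireg s k_reg = k" by (auto simp: nb_def k_def)
  have neq: "nb a' \<noteq> nb a" if "a' < d + 1" "a' \<noteq> a" for a'
    using bij that 5(2) by (auto simp: bij_betw_def dest: inj_onD)
  have "nb a \<in> N" using bij 5(2) by (auto simp: bij_betw_def)
  show ?case
  proof (rule halts_RStore, goal_cases)
    case 1
    then show ?case using u w by simp
  next
    case 2
    show ?case using 5(4,5) u neq \<open>nb a \<in> N\<close> by (auto simp: nb' less_Suc_eq[of _ a])
  qed simp
qed (use d in \<open>auto simp: unchanged_def\<close>)

lemma halts_update_projector:
  assumes d: "ireg s d_reg = d" and w: "rarr s scalar_arr 0 0 \<noteq> 0"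
  shows "halts_within update_projector s (8 + (d + 1) * (18 + 28 * (d + 1)))
     (\<lambda>s'. \<forall>a<d + 1. \<forall>b<d + 1. rarr s' projector_arr a b = rarr s projector_arr a b -
        rarr s direction_arr a 0 * rarr s direction_arr b 0 / rarr s scalar_arr 0 0)"
  (is "halts_within _ _ _ (\<lambda>s'. \<forall>a<d + 1. \<forall>b<d + 1. _ = ?new a b)")
  unfolding update_projector_def
proof (rule halts_For[where I = "\<lambda>a s'. \<forall>a' b'. rarr s' projector_arr a' b' =
        (if a' < a \<and> b' < d + 1 then ?new a' b' else rarr s projector_arr a' b')" and l = 0
      and h = "d + 1" and T = "8 + (d + 1) * 28"], goal_cases)
  case (5 a s1)
  note u1 = 5(3)[unfolded unchanged_def, simplified]
  show ?case
  proof (rule halts_For[where I = "\<lambda>b s'. \<forall>a' b'. rarr s' projector_arr a' b' =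
        (if a' < a \<and> b' < d + 1 \<or> a' = a \<and> b' < b then ?new a' b' else rarr s projector_arr a' b')" and l = 0
      and h = "d + 1" and T = "18"], goal_cases)
    case (5 b s2)
    note u2 = 5(3)[unfolded unchanged_def, simplified]
    show ?case
      by (rule halts_RStore) (use \<open>ireg s1 a_reg = a\<close> 5 u1 u2 d w in \<open>auto simp: less_Suc_eq\<close>)
  qed (use 5 u1 d in \<open>auto simp: unchanged_def less_Suc_eq\<close>)
qed (use d in \<open>auto simp: unchanged_def\<close>)

lemma halts_init_projector:
  assumes d: "ireg s d_reg = d"
  shows "halts_within init_projector s (8 + (d + 1) * (22 + 14 * (d + 1)))
     (\<lambda>s'. \<forall>a<d + 1. \<forall>b<d + 1. rarr s' projector_arr a b = of_bool (a = b))"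
  unfolding init_projector_def
proof (rule halts_For[where I = "\<lambda>a s'. \<forall>a'<a. \<forall>b'<d + 1. rarr s' projector_arr a' b' = of_bool (a' = b')"
      and l = 0 and h = "d + 1" and T = "12 + (d + 1) * 14"], goal_cases)
  case (5 a s1)
  note u1 = 5(3)[unfolded unchanged_def, simplified]
  let ?J = "\<lambda>b s'. \<forall>a'\<le>a. \<forall>b'<(if a' = a then b else d + 1). 
      rarr s' projector_arr a' b' = (if a' = a then 0 else of_bool (a' = b'))"
  show ?case
  proof (rule halts_Seq[where T' = 4], rule halts_For[where I = ?J and l = 0 and h = "d + 1" and T = "4"
        and Q = "?J (d + 1)" and T' = "8 + (d + 1) * 14"], goal_cases)
    case (5 b s2)
    note u2 = 5(3)[unfolded unchanged_def, simplified]
    show ?case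
      by (rule halts_RStore) (use \<open>ireg s1 a_reg = a\<close> 5 u1 u2 d in \<open>auto simp: less_Suc_eq\<close>)
  next
    case (8 s2)
    note u2 = 8(1)[unfolded unchanged_def, simplified]
    show ?case
      by (rule halts_RStore) (use \<open>ireg s1 a_reg = a\<close> 8 u1 u2 d in \<open>auto simp: less_Suc_eq\<close>)
  qed (use 5 u1 d in \<open>auto simp: unchanged_def less_Suc_eq\<close>)
qed (use d in \<open>auto simp: unchanged_def\<close>)

lemma halts_load_points:
  assumes input: "holds_input s d n E P \<pi>" and perm: "\<pi> permutes {..<n}"
  shows "halts_within load_points s (8 + (d + 1) * (16 + 20 * n))
     (\<lambda>s'. \<forall>r<d + 1. \<forall>i<n. rarr s' extended_arr r i = extended_entry d P r (\<pi> i))"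
  unfolding load_points_def
proof (rule halts_For[where I = "\<lambda>r s'. \<forall>r'<r. \<forall>i<n. rarr s' extended_arr r' i = extended_entry d P r' (\<pi> i)"
      and l = 0 and h = "d + 1" and T = "6 + n * 20"], goal_cases)
  case (5 r s1)
  have in1: "holds_input s1 d n E P \<pi>" by (rule holds_input_unchanged[OF input 5(3)]) auto
  show ?case
  proof (rule halts_For[where I = "\<lambda>i s'. (\<forall>r'<r. \<forall>i<n. rarr s' extended_arr r' i = extended_entry d P r' (\<pi> i)) \<and>
        (\<forall>i'<i. rarr s' extended_arr r i' = extended_entry d P r (\<pi> i'))"
      and l = 0 and h = n and T = 12], goal_cases)
    case (5 i s2)
    have in2: "holds_input s2 d n E P \<pi>" by (rule holds_input_unchanged[OF in1 5(3)]) auto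
    have "\<pi> i < n" using permutes_in_image[OF perm] 5(2) by simp
    moreover have "ireg s2 r_reg = r" using 5(3) \<open>ireg s1 r_reg = r\<close> by (simp add: unchanged_def)
    ultimately show ?case
      using in2 5
      by (intro halts_Cond[where T = 8] halts_RStore)
         (auto simp: holds_input_def extended_entry_def less_Suc_eq)
  qed (use 5 in1 in \<open>auto simp: unchanged_def less_Suc_eq holds_input_def\<close>)
qed (use input in \<open>auto simp: unchanged_def holds_input_def\<close>)

lemma bij_betw_append:
  assumes "bij_betw f {..<c} N" "x \<notin> N"
  shows "bij_betw (f(c := x)) {..<Suc c} (insert x N)"
proof -
  have "bij_betw (f(c := x)) {..<c} N"
    using assms(1) by (rule bij_betw_cong[THEN iffD1, rotated]) simp
  then have "bij_betw (f(c := x)) ({..<c} \<union> {c}) (N \<union> {x})"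
    using assms(2) by (intro bij_betw_combine) (auto simp: bij_betw_def)
  then show ?thesis by (simp add: lessThan_Suc)
qed

text \<open>
  The list of neighbours is described by a bijection from the positions in the list, which yields
  at once that the list has the length \<open>card N\<close> and contains no repetition.
\<close>

lemma halts_prescribe_column:
  assumes input: "holds_input s d n E P \<pi>" and perm: "\<pi> permutes {..<n}"
    and k: "ireg s k_reg = k" "k < n"
  defines "N \<equiv> {i. i < k \<and> {\<pi> i, \<pi> k} \<in> E}" and "U \<equiv> rarr s column_arr"
  shows "halts_within prescribe_column s (12 + n * (38 + 24 * n))
     (\<lambda>s'. bij_betw (\<lambda>c. iarr s' nbr_arr c 0) {..<card N} N \<and>
        rarr s' column_arr k k = 1 \<and>
        (\<forall>i. k < i \<and> i < n \<longrightarrow> rarr s' column_arr i k = 0) \<and>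
        (\<forall>i<k. i \<notin> N \<longrightarrow> rarr s' column_arr i k = - (\<Sum>l=Suc k..<n. U i l * U k l)) \<and>
        (\<forall>i l. l \<noteq> k \<longrightarrow> rarr s' column_arr i l = U i l))"
proof -
  \<comment> \<open>The final value of entry \<open>i\<close>, except on the diagonal, which is set after the loop.\<close>
  define v where "v i = (if i < k \<and> i \<notin> N then - (\<Sum>l=Suc k..<n. U i l * U k l) else 0)" for i
  define I where "I i s' \<longleftrightarrow>
      bij_betw (\<lambda>c. iarr s' nbr_arr c 0) {..<ireg s' count_reg} {i' \<in> N. i' < i} \<and>
      (\<forall>i'<i. rarr s' column_arr i' k = v i') \<and>
      (\<forall>i l. l \<noteq> k \<longrightarrow> rarr s' column_arr i l = U i l)" for i and s' :: state
  have pi: "\<pi> i < n" if "i < n" for i using permutes_in_image[OF perm] that by simp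
  show ?thesis
    unfolding prescribe_column_def
  proof (rule halts_Seq[where T = 2 and T' = "10 + n * (38 + 24 * n)" and R = "\<lambda>s1. ireg s1 count_reg = 0"],
      goal_cases)
    case 1
    show ?case by (rule halts_IAssign) auto
  next
    case (2 s1)
    note u1 = 2(1)[unfolded unchanged_def, simplified]
    show ?case
    proof (rule halts_Seq[where T = "6 + n * (38 + 24 * n)" and T' = 4 and R = "I n"], goal_cases)
      case 1
      show ?case
      proof (rule halts_For[where I = I and l = 0 and h = n and T = "30 + 24 * n"], goal_cases)
        case 4
        show ?case using 2 u1 by (auto simp: I_def U_def bij_betw_def)
      next
        case (5 i s2)
        note u2 = 5(3)[unfolded unchanged_def, simplified]
        have in2: "holds_input s2 d n E P \<pi>"
          by (rule holds_input_unchanged[OF holds_input_unchanged[OF input 2(1)] 5(3)]) auto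
        note I2 = 5(5)[unfolded I_def]
        have k2: "ireg s2 k_reg = k" using u1 u2 k by simp
        show ?case
        proof (rule halts_Seq[where T = 4 and T' = "26 + 24 * n" and R = "\<lambda>s3. rarr s3 column_arr =
              (rarr s2 column_arr)(i := (rarr s2 column_arr i)(k := 0))"], goal_cases)
          case 1
          show ?case by (rule halts_RStore) (use 5 k2 in auto)
        next
          case (2 s3)
          note u3 = 2(1)[unfolded unchanged_def, simplified]
          have in3: "holds_input s3 d n E P \<pi>" by (rule holds_input_unchanged[OF in2 2(1)]) auto
          have r3: "ireg s3 i_reg = i" "ireg s3 k_reg = k" using u3 5 k2 by auto
          have adj: "ival (IAt adjacency_arr (vertex_at i_reg) (vertex_at k_reg)) s3 =
              (if {\<pi> i, \<pi> k} \<in> E then 1 else 0)"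
            using in3 r3 5(2) k(2) pi by (simp add: holds_input_def)
          have cols3: "\<forall>i'<i. rarr s3 column_arr i' k = v i'" "rarr s3 column_arr i k = 0"
            "\<forall>i l. l \<noteq> k \<longrightarrow> rarr s3 column_arr i l = U i l"
            using 2(2) I2 by auto
          have nbrs3: "bij_betw (\<lambda>c. iarr s3 nbr_arr c 0) {..<ireg s3 count_reg} {i' \<in> N. i' < i}"
            using I2 u3 by simp
          have skip: "{i' \<in> N. i' < Suc i} = {i' \<in> N. i' < i}" if "i \<notin> N"
            using that by (auto simp: less_Suc_eq)
          show ?case
          proof (rule halts_Cond[where T = "22 + 24 * n"], goal_cases)
            case 2
            then have ik: "i < k" using r3 by simp
            show ?case
            proof (rule halts_Cond[where T = "12 + 24 * n"], goal_cases)
              case 2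
              then have "i \<in> N" using adj ik by (auto simp: N_def split: if_splits)
              then have vi: "v i = 0" by (simp add: v_def)
              have grow: "{i' \<in> N. i' < Suc i} = insert i {i' \<in> N. i' < i}"
                using \<open>i \<in> N\<close> by (auto simp: less_Suc_eq)
              have bij: "bij_betw ((\<lambda>c. iarr s3 nbr_arr c 0)(ireg s3 count_reg := i))
                  {..<Suc (ireg s3 count_reg)} {i' \<in> N. i' < Suc i}"
                unfolding grow using nbrs3 by (rule bij_betw_append) simp
              show ?case
              proof (rule halts_Seq[where T = 4 and T' = "4" and R = "\<lambda>s4. iarr s4 nbr_arr =
                    (iarr s3 nbr_arr)(ireg s3 count_reg := (iarr s3 nbr_arr (ireg s3 count_reg))(0 := i))"],
                  goal_cases)
                case 1
                show ?case by (rule halts_IStore) (use r3 in auto)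
              next
                case (2 s4)
                note u4 = 2(1)[unfolded unchanged_def, simplified]
                have "(\<lambda>c. iarr s4 nbr_arr c 0) = (\<lambda>c. iarr s3 nbr_arr c 0)(ireg s3 count_reg := i)"
                  using 2(2) by auto
                then show ?case
                  using bij cols3 u4 vi by (intro halts_IAssign) (auto simp: I_def less_Suc_eq)
              qed auto
            next
              case 3
              then have "i \<notin> N" using adj ik by (auto simp: N_def split: if_splits)
              then have vi: "v i = (\<Sum>l=Suc k..<n. 0 - U i l * U k l)"
                using ik by (simp add: v_def sum_negf)
              show ?case
              proof (rule halts_conseq, rule halts_Accumulate[where i = i and j = k and l = "Suc k" and h = n
                    and G = "\<lambda>l. 0 - U i l * U k l" and T = "12 + 24 * n"], goal_cases)
                case 1
                then show ?case using r3 in3 by (auto simp: unchanged_def holds_input_def)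
              next
                case 2
                then show ?case using r3 in3 by (auto simp: unchanged_def)
              next
                case 3
                then show ?case using r3 cols3 by (auto simp: unchanged_def)
              next
                case 4
                show ?case by simp
              next
                case (6 s4)
                note u4 = 6(1)[unfolded unchanged_def, simplified]
                show ?case
                  using 6(2) cols3 vi u4 nbrs3 skip[OF \<open>i \<notin> N\<close>]
                  by (auto simp: I_def less_Suc_eq)
              qed simp
            qed auto
          next
            case 3
            then have "i \<notin> N" "v i = 0" using r3 by (auto simp: N_def v_def)
            then show ?case
              using cols3 nbrs3 skip by (intro halts_Skip) (auto simp: I_def less_Suc_eq)
          qed auto
        qed simp
      qed (use 2 u1 input in \<open>auto simp: unchanged_def holds_input_def\<close>)
    next
      case (2 s2)
      note u2 = 2(1)[unfolded unchanged_def, simplified]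
      have "{i' \<in> N. i' < n} = N" using k(2) by (auto simp: N_def)
      then have bij: "bij_betw (\<lambda>c. iarr s2 nbr_arr c 0) {..<ireg s2 count_reg} N"
        using 2(2) by (simp add: I_def)
      then have "ireg s2 count_reg = card N" using bij_betw_same_card by fastforce
      moreover have "ireg s2 k_reg = k" using u1 u2 k by simp
      ultimately show ?case
        using bij 2(2) k(2) by (intro halts_RStore) (auto simp: I_def v_def)
    qed simp
  qed simp
qed

lemma sum_correction:
  fixes f U V :: "nat \<Rightarrow> real"
  assumes bij: "bij_betw nb {..<D} N" and N: "N \<subseteq> {..<n}"
    and on: "\<And>a. a < D \<Longrightarrow> V (nb a) = U (nb a) - t * p a" and off: "\<And>i. i \<notin> N \<Longrightarrow> V i = U i"
  shows "(\<Sum>i<n. f i * V i) = (\<Sum>i<n. f i * U i) - t * (\<Sum>a<D. f (nb a) * p a)"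
proof -
  have "(\<Sum>i<n. f i * V i) - (\<Sum>i<n. f i * U i) = (\<Sum>i<n. f i * (V i - U i))"
    by (simp add: right_diff_distrib sum_subtractf)
  also have "\<dots> = (\<Sum>i\<in>N. f i * (V i - U i))"
    using N off by (intro sum.mono_neutral_right) auto
  also have "\<dots> = (\<Sum>a<D. f (nb a) * (V (nb a) - U (nb a)))"
    by (rule sum.reindex_bij_betw[OF bij, symmetric])
  also have "\<dots> = - (t * (\<Sum>a<D. f (nb a) * p a))"
    using on by (simp add: sum_distrib_left sum_negf[symmetric] mult_ac)
  finally show ?thesis by simp
qed

text \<open>
  The correction \<open>e / w\<close> times \<open>p\<close> removes the residual \<open>e\<close> of equation \<open>r\<close>, as \<open>p \<bullet> q\<^sub>r = w\<close>, and keeps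
  the earlier equations, as \<open>p\<close> is orthogonal to their rows.
\<close>

lemma halts_solve_row:
  fixes A :: "nat \<Rightarrow> nat \<Rightarrow> real" and s
  defines "nb \<equiv> \<lambda>a. iarr s nbr_arr a 0"
  defines "q \<equiv> \<lambda>j a. A j (nb a)"
  assumes regs: "ireg s n_reg = n" "ireg s d_reg = d" "ireg s k_reg = k" "ireg s r_reg = r"
    and r: "r < d + 1" and bij: "bij_betw nb {..<d + 1} N" and N: "N \<subseteq> {..<n}"
    and A: "\<And>j i. j < d + 1 \<Longrightarrow> i < n \<Longrightarrow> rarr s extended_arr j i = A j i"
    and H: "projector (d + 1) q r (rarr s projector_arr)" and ind: "rows_independent (d + 1) q"
    and U: "\<And>j. j < r \<Longrightarrow> (\<Sum>i<n. A j i * rarr s column_arr i k) = 0"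
  shows "halts_within solve_row s (46 + 22 * n + (d + 1) * (98 + 54 * (d + 1)))
     (\<lambda>s'. projector (d + 1) q (Suc r) (rarr s' projector_arr) \<and>
        (\<forall>j<Suc r. (\<Sum>i<n. A j i * rarr s' column_arr i k) = 0) \<and>
        (\<forall>i l. l \<noteq> k \<or> i \<notin> N \<longrightarrow> rarr s' column_arr i l = rarr s column_arr i l))"
proof -
  let ?D = "d + 1"
  define p where "p a = (\<Sum>b<?D. rarr s projector_arr a b * q r b)" for a
  define w where "w = (\<Sum>a<?D. p a * q r a)"
  define e where "e = (\<Sum>i<n. A r i * rarr s column_arr i k)"
  note step = projection_orthogonal[OF H ind r, folded p_def]
    projection_pivot_nonzero[OF H ind r, folded p_def, folded w_def]
    projector_step[OF H ind r, folded p_def, folded w_def]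
  have nbn: "nb a < n" if "a < ?D" for a using bij N that by (auto simp: bij_betw_def)
  have q: "rarr s extended_arr r (iarr s nbr_arr a 0) = q r a" if "a < ?D" for a
    using A[OF r nbn[OF that]] by (simp add: q_def nb_def)
  have new_sums: "(\<Sum>i<n. A j i * V i) = 0"
    if j: "j < Suc r" and on: "\<And>a. a < ?D \<Longrightarrow> V (nb a) = rarr s column_arr (nb a) k - e / w * p a"
      and off: "\<And>i. i \<notin> N \<Longrightarrow> V i = rarr s column_arr i k" for j V
  proof -
    have "(\<Sum>i<n. A j i * V i) =
        (\<Sum>i<n. A j i * rarr s column_arr i k) - e / w * (\<Sum>a<?D. q j a * p a)"
      unfolding q_def by (rule sum_correction[where nb = nb and U = "\<lambda>i. rarr s column_arr i k" and p = p, OF bij N])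
        (use on off in auto)
    also have "\<dots> = 0"
    proof (cases "j = r")
      case True
      then have "(\<Sum>a<?D. q j a * p a) = w" by (simp only: w_def mult.commute)
      then show ?thesis using True step(2) by (simp add: e_def)
    next
      case False
      then have "j < r" using j by simp
      then show ?thesis by (simp only: U step(1) mult_zero_right diff_0_right)
    qed
    finally show ?thesis .
  qed
  show ?thesis
    unfolding solve_row_def
  proof (rule halts_Seq[where T' = "38 + 22 * n + ?D * (76 + 28 * ?D)", OF halts_compute_direction[OF regs(2)]], goal_cases)
    case (1 s1)
    note u1 = 1(1)[unfolded unchanged_def, simplified]
    have p1: "rarr s1 direction_arr a 0 = p a" if "a < ?D" for a
    proof -
      have "rarr s1 direction_arr a 0 = (\<Sum>b<?D. rarr s projector_arr a b *
          rarr s extended_arr (ireg s r_reg) (iarr s nbr_arr b 0))" using 1(2) that by blast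
      also have "\<dots> = p a" unfolding p_def using q by (intro sum.cong) (auto simp: regs)
      finally show ?thesis .
    qed
    have d1: "ireg s1 d_reg = d" using u1 regs by simp
    show ?case
    proof (rule halts_Seq[where T' = "26 + 22 * n + ?D * (50 + 28 * ?D)", OF halts_compute_pivot[OF d1]], goal_cases)
      case (1 s2)
      note u2 = 1(1)[unfolded unchanged_def, simplified]
      have w2: "rarr s2 scalar_arr 0 0 = w"
        unfolding 1(2) w_def by (intro sum.cong) (use u1 p1 q regs in auto)
      have n2: "ireg s2 n_reg = n" using u1 u2 regs by simp
      show ?case
      proof (rule halts_Seq[where T' = "16 + ?D * (50 + 28 * ?D)", OF halts_compute_residual[OF n2]], goal_cases)
        case (1 s3)
        note u3 = 1(1)[unfolded unchanged_def, simplified]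
        have w3: "rarr s3 scalar_arr 0 0 = w" using 1(2) w2 by simp
        have e3: "rarr s3 scalar_arr 0 1 = e"
          unfolding 1(2)[THEN conjunct2] e_def by (intro sum.cong) (use u1 u2 regs A r in auto)
        have correct: "halts_within correct_column s3 (8 + ?D * 32)
           (\<lambda>s'. (\<forall>a<?D. rarr s' column_arr (nb a) k = rarr s column_arr (nb a) k - e / w * p a) \<and>
              (\<forall>i l. l \<noteq> k \<or> i \<notin> N \<longrightarrow> rarr s' column_arr i l = rarr s column_arr i l))"
          using halts_correct_column[of s3 d N] bij regs u1 u2 u3 step(2) w3 e3 p1 by (simp add: nb_def)
        show ?case
        proof (rule halts_Seq[where T' = "8 + ?D * (18 + 28 * ?D)", OF correct], goal_cases)
          case (1 s4)
          note u4 = 1(1)[unfolded unchanged_def, simplified]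
          have d4: "ireg s4 d_reg = d" "rarr s4 scalar_arr 0 0 = w" using regs u1 u2 u3 u4 w3 by auto
          show ?case
          proof (rule halts_conseq[OF halts_update_projector[OF d4(1)]], goal_cases)
            case (3 s5)
            note u5 = 3(1)[unfolded unchanged_def, simplified]
            have "projector ?D q (Suc r) (rarr s5 projector_arr)"
              by (rule projector_cong[OF step(3)])
                (use 3(2) p1 d4 u1 u2 u3 u4 in auto)
            moreover have "(\<Sum>i<n. A j i * rarr s5 column_arr i k) = 0" if "j < Suc r" for j
              by (rule new_sums[OF that]) (use 1(2) u5 in auto)
            ultimately show ?case using 1(2) u5 by auto
          qed (use d4 step(2) in auto)
        qed (simp add: algebra_simps)
      qed (simp add: algebra_simps)
    qed (simp add: algebra_simps)
  qed (simp add: algebra_simps)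
qed

section \<open>Correctness and running time of the whole program\<close>

lemma halts_solve_column:
  fixes A :: "nat \<Rightarrow> nat \<Rightarrow> real" and s
  defines "nb \<equiv> \<lambda>a. iarr s nbr_arr a 0"
  assumes regs: "ireg s n_reg = n" "ireg s d_reg = d" "ireg s k_reg = k"
    and bij: "bij_betw nb {..<d + 1} N" and N: "N \<subseteq> {..<n}"
    and A: "\<And>j i. j < d + 1 \<Longrightarrow> i < n \<Longrightarrow> rarr s extended_arr j i = A j i"
    and ind: "rows_independent (d + 1) (\<lambda>j a. A j (nb a))"
  shows "halts_within solve_column s
      (16 + (d + 1) * (22 + 14 * (d + 1)) + (d + 1) * (56 + 22 * n + (d + 1) * (98 + 54 * (d + 1))))
     (\<lambda>s'. (\<forall>j<d + 1. (\<Sum>i<n. A j i * rarr s' column_arr i k) = 0) \<and>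
        (\<forall>i l. l \<noteq> k \<or> i \<notin> N \<longrightarrow> rarr s' column_arr i l = rarr s column_arr i l))"
  unfolding solve_column_def
proof (rule halts_Seq[where T' = "8 + (d + 1) * (56 + 22 * n + (d + 1) * (98 + 54 * (d + 1)))",
      OF halts_init_projector[OF regs(2)]], goal_cases)
  case (1 s1)
  note u1 = 1(1)[unfolded unchanged_def, simplified]
  let ?q = "\<lambda>j a. A j (nb a)"
  define I where "I r s' \<longleftrightarrow> projector (d + 1) ?q r (rarr s' projector_arr) \<and>
        (\<forall>j<r. (\<Sum>i<n. A j i * rarr s' column_arr i k) = 0) \<and>
        (\<forall>i l. l \<noteq> k \<or> i \<notin> N \<longrightarrow> rarr s' column_arr i l = rarr s column_arr i l)" for r and s' :: state
  show ?case
  proof (rule halts_For[where I = I and l = 0 and h = "d + 1"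
        and T = "46 + 22 * n + (d + 1) * (98 + 54 * (d + 1))"], goal_cases)
    case 4
    have "projector (d + 1) ?q 0 (rarr s1 projector_arr)"
      by (rule projector_cong[OF projector_identity]) (use 1(2) in auto)
    then show ?case using u1 by (simp add: I_def)
  next
    case (5 r s2)
    note u2 = 5(3)[unfolded unchanged_def, simplified]
    have nb2: "iarr s2 nbr_arr a 0 = nb a" for a using u1 u2 by (simp add: nb_def)
    have regs2: "ireg s2 n_reg = n" "ireg s2 d_reg = d" "ireg s2 k_reg = k" "ireg s2 r_reg = r"
      using regs u1 u2 5(4) by auto
    have A2: "rarr s2 extended_arr j i = A j i" if "j < d + 1" "i < n" for j i
      using A[OF that] u1 u2 by simp
    note I2 = 5(5)[unfolded I_def]
    show ?case
      by (rule halts_conseq[OF halts_solve_row[OF regs2 5(2), where N = N and A = A, unfolded nb2]])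
         (use bij N A2 I2 ind in \<open>auto simp: I_def\<close>)
  next
    case (6 s2)
    then show ?case by (simp add: I_def)
  qed (use regs u1 in \<open>auto simp: unchanged_def solve_row_def[symmetric]\<close>)
qed (simp add: algebra_simps)

lemma stress_column_cong:
  assumes "stress_column d n E P \<pi> U k" "\<And>i l. k \<le> l \<Longrightarrow> V i l = U i l"
  shows "stress_column d n E P \<pi> V k"
proof -
  have "(\<Sum>l=Suc k..<n. V i l * V k l) = (\<Sum>l=Suc k..<n. U i l * U k l)" for i
    using assms(2) by simp
  then show ?thesis using assms by (simp add: stress_column_def)
qed

text \<open>
  The invariant after \<open>m\<close> rounds concerns the last \<open>m\<close> columns. It survives the next round because the
  condition on a column refers only to that column and to later ones. The lateration ordering provides
  exactly \<open>d + 1\<close> neighbours, hence a square system, which is regular by general position.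
\<close>

lemma halts_compute_columns:
  assumes input: "holds_input s d n E P \<pi>" and lat: "lateration_ordering (d + 1) n E \<pi>"
    and gp: "general_position d n P"
    and A: "\<And>j i. j < d + 1 \<Longrightarrow> i < n \<Longrightarrow> rarr s extended_arr j i = extended_entry d P j (\<pi> i)"
  shows "halts_within compute_columns s
      (10 + n * (46 + n * (38 + 24 * n) +
         (d + 1) * (22 + 14 * (d + 1)) + (d + 1) * (56 + 22 * n + (d + 1) * (98 + 54 * (d + 1)))))
     (\<lambda>s'. \<forall>k. d < k \<and> k < n \<longrightarrow> stress_column d n E P \<pi> (rarr s' column_arr) k)"
proof -
  have perm: "\<pi> permutes {..<n}" using lat by (simp add: lateration_ordering_def)
  have pi: "\<pi> i < n" if "i < n" for i using permutes_in_image[OF perm] that by simp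
  let ?Tsolve = "16 + (d + 1) * (22 + 14 * (d + 1)) + (d + 1) * (56 + 22 * n + (d + 1) * (98 + 54 * (d + 1)))"
  let ?Tpre = "12 + n * (38 + 24 * n)"
  show ?thesis
    unfolding compute_columns_def
  proof (rule halts_For[where I = "\<lambda>m s'. \<forall>k. n - m \<le> k \<and> k < n \<longrightarrow> stress_column d n E P \<pi> (rarr s' column_arr) k"
        and l = 0 and h = "n - (d + 1)" and T = "6 + (?Tpre + ?Tsolve)"], goal_cases)
    case (5 m s1)
    have in1: "holds_input s1 d n E P \<pi>" by (rule holds_input_unchanged[OF input 5(3)]) auto
    note u1 = 5(3)[unfolded unchanged_def, simplified]
    define k where "k = n - 1 - m"
    have k: "d < k" "k < n" "n - m = Suc k" "n - Suc m = k" using 5(2) by (auto simp: k_def)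
    define N where "N = {i. i < k \<and> {\<pi> i, \<pi> k} \<in> E}"
    have card: "card N = d + 1" using lat k unfolding lateration_ordering_def N_def by simp
    have N: "N \<subseteq> {..<n}" using k by (auto simp: N_def)
    show ?case
    proof (rule halts_Seq[where T = 6 and T' = "?Tpre + ?Tsolve" and
          R = "\<lambda>s2. ireg s2 k_reg = k \<and> rarr s2 = rarr s1"], goal_cases)
      case 1
      show ?case by (rule halts_IAssign) (use 5 in1 in \<open>auto simp: k_def holds_input_def\<close>)
    next
      case (2 s2)
      note u2 = 2(1)[unfolded unchanged_def, simplified]
      have in2: "holds_input s2 d n E P \<pi>" by (rule holds_input_unchanged[OF in1 2(1)]) auto
      have k2: "ireg s2 k_reg = k" using 2(2) by simp
      let ?U = "rarr s1 column_arr"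
      show ?case
      proof (rule halts_Seq[where T' = "?Tsolve",
            OF halts_prescribe_column[OF in2 perm k2 k(2), folded N_def, unfolded card]], goal_cases)
        case (1 s3)
        note u3 = 1(1)[unfolded unchanged_def, simplified]
        have in3: "holds_input s3 d n E P \<pi>" by (rule holds_input_unchanged[OF in2 1(1)]) auto
        have regs3: "ireg s3 n_reg = n" "ireg s3 d_reg = d" "ireg s3 k_reg = k"
          using in3 k2 u3 by (auto simp: holds_input_def)
        define nb where "nb = (\<lambda>a. iarr s3 nbr_arr a 0)"
        have bij: "bij_betw nb {..<d + 1} N" using 1(2) by (simp add: nb_def)
        have A3: "rarr s3 extended_arr j i = extended_entry d P j (\<pi> i)" if "j < d + 1" "i < n" for j i
          using A[OF that] u1 u2 u3 by simp
        have nbn: "nb a < n" if "a < d + 1" for a using bij N that by (auto simp: bij_betw_def)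
        have "inj_on (\<lambda>a. \<pi> (nb a)) {..<d + 1}"
          using bij permutes_inj[OF perm] by (auto simp: bij_betw_def inj_on_def inj_def)
        then have ind: "rows_independent (d + 1) (\<lambda>j a. extended_entry d P j (\<pi> (nb a)))"
          by (rule general_position_rows_independent[OF gp]) (use nbn pi in auto)
        show ?case
        proof (rule halts_conseq[OF halts_solve_column[OF regs3,
                where A = "\<lambda>j i. extended_entry d P j (\<pi> i)" and N = N, folded nb_def]], goal_cases)
          case (6 s4)
          let ?V = "rarr s4 column_arr"
          have later: "?V i l = ?U i l" if "l \<noteq> k" for i l
            using 6(2) 1(2) 2(2) that by auto
          have fixed: "?V i k = rarr s3 column_arr i k" if "i \<notin> N" for i using 6(2) that by auto
          have "k \<notin> N" "\<And>i. k < i \<Longrightarrow> i \<notin> N" by (auto simp: N_def)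
          moreover have "(\<Sum>l=Suc k..<n. ?V i l * ?V k l) = (\<Sum>l=Suc k..<n. ?U i l * ?U k l)" for i
            using later by simp
          ultimately have "stress_column d n E P \<pi> ?V k"
            unfolding stress_column_def using 6(2) 1(2) 2(2) fixed by (auto simp: N_def)
          moreover have "stress_column d n E P \<pi> ?V k'" if "k < k'" "k' < n" for k'
          proof (rule stress_column_cong)
            show "stress_column d n E P \<pi> ?U k'" using 5(5) k(3) that by simp
            show "?V i l = ?U i l" if "k' \<le> l" for i l using later that \<open>k < k'\<close> by simp
          qed
          ultimately show ?case using k(4) by (auto simp: le_eq_less_or_eq)
        qed (use bij N A3 ind in \<open>auto simp: nb_def\<close>)
      qed simp
    qed simp
  next
    case 7
    have "1 + 5 + 4 + (n - (d + 1)) * (6 + (?Tpre + ?Tsolve) + 5 + 7) \<le> 10 + n * (6 + (?Tpre + ?Tsolve) + 5 + 7)"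
      by (intro add_mono mult_right_mono) auto
    then show ?case by (simp add: algebra_simps)
  qed (use input in \<open>auto simp: unchanged_def holds_input_def\<close>)
qed

lemma halts_multiply_columns:
  assumes input: "holds_input s d n E P \<pi>" and perm: "\<pi> permutes {..<n}"
  defines "U \<equiv> rarr s column_arr"
  shows "halts_within multiply_columns s (6 + n * (14 + n * (24 + n * 30)))
     (\<lambda>s'. \<forall>i<n. \<forall>j<n. rarr s' stress_arr (\<pi> i) (\<pi> j) = (\<Sum>l=Suc d..<n. U i l * U j l))"
proof -
  have inj: "\<pi> i = \<pi> j \<longleftrightarrow> i = j" for i j using permutes_inj[OF perm] by (auto simp: inj_def)
  let ?S = "\<lambda>i j. \<Sum>l=Suc d..<n. U i l * U j l"
  show ?thesis
    unfolding multiply_columns_def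
  proof (rule halts_For[where I = "\<lambda>i s'. \<forall>i'<i. \<forall>j<n. rarr s' stress_arr (\<pi> i') (\<pi> j) = ?S i' j"
        and l = 0 and h = n and T = "6 + n * (24 + n * 30)"], goal_cases)
    case (5 i s1)
    note u1 = 5(3)[unfolded unchanged_def, simplified]
    have in1: "holds_input s1 d n E P \<pi>" by (rule holds_input_unchanged[OF input 5(3)]) auto
    show ?case
    proof (rule halts_For[where I = "\<lambda>j s'. (\<forall>i'<i. \<forall>j'<n. rarr s' stress_arr (\<pi> i') (\<pi> j') = ?S i' j') \<and>
            (\<forall>j'<j. rarr s' stress_arr (\<pi> i) (\<pi> j') = ?S i j')"
          and l = 0 and h = n and T = "16 + n * 30"], goal_cases)
      case (5 j s2)
      note u2 = 5(3)[unfolded unchanged_def, simplified]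
      have in2: "holds_input s2 d n E P \<pi>" by (rule holds_input_unchanged[OF in1 5(3)]) auto
      have r2: "ireg s2 i_reg = i" "ireg s2 b_reg = j" using u2 5 \<open>ireg s1 i_reg = i\<close> by auto
      show ?case
      proof (rule halts_conseq, rule halts_Accumulate[where i = "\<pi> i" and j = "\<pi> j" and l = "Suc d" and h = n
            and G = "\<lambda>l. U i l * U j l" and T = "16 + n * 30"], goal_cases)
        case 1
        then show ?case using r2 in2 \<open>i < n\<close> 5(2) by (auto simp: unchanged_def holds_input_def)
      next
        case 2
        then show ?case using in2 by (auto simp: unchanged_def holds_input_def)
      next
        case 3
        then show ?case using r2 u1 u2 by (auto simp: unchanged_def U_def)
      next
        case (6 s3)
        show ?case using 6(2) 5(5) \<open>i < n\<close> 5(2) by (auto simp: inj less_Suc_eq)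
      qed auto
    qed (use 5 in1 in \<open>auto simp: unchanged_def holds_input_def less_Suc_eq\<close>)
  qed (use input in \<open>auto simp: unchanged_def holds_input_def algebra_simps\<close>)
qed

text \<open>
  The bound is a polynomial in \<open>n\<close> and \<open>D = d + 1\<close> in which every monomial except \<open>n D\<^sup>3\<close> is at most
  \<open>n\<^sup>3\<close>, since \<open>D \<le> n\<close>. For the remaining one, \<open>D \<le> 2 d\<close> if \<open>d > 0\<close>, and \<open>D\<^sup>3 = 1\<close> if \<open>d = 0\<close>.
\<close>

lemma stress_program_time:
  fixes d n :: nat
  assumes "d + 1 \<le> n"
  shows "8 + (d + 1) * (16 + 20 * n) + ((10 + n * (46 + n * (38 + 24 * n) +
         (d + 1) * (22 + 14 * (d + 1)) + (d + 1) * (56 + 22 * n + (d + 1) * (98 + 54 * (d + 1))))) +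
       (6 + n * (14 + n * (24 + n * 30)))) \<le> 1000 * (n ^ 3 + n * d ^ 3)" (is "?T \<le> _")
proof -
  let ?D = "d + 1"
  have "1 \<le> n" using assms by simp
  then have n3: "1 \<le> n ^ 3" "n \<le> n ^ 3" "n * n \<le> n ^ 3"
    by (auto simp: power3_eq_cube)
  have lead: "n * (?D * (?D * ?D)) \<le> 8 * (n * d ^ 3) + 8 * n"
  proof (cases "d = 0")
    case False
    then have "?D ^ 3 \<le> (2 * d) ^ 3" by (intro power_mono) auto
    then have "n * ?D ^ 3 \<le> n * (8 * d ^ 3)" by (intro mult_left_mono) (auto simp: power_mult_distrib)
    then show ?thesis by (simp add: power3_eq_cube mult_ac)
  qed simp
  have "?D * ?D \<le> n * n" using assms by (rule mult_mono) (use assms in auto)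
  then have mono: "?D \<le> n" "?D * n \<le> n * n" "n * ?D \<le> n * n"
    "n * (?D * n) \<le> n ^ 3" "n * (?D * ?D) \<le> n ^ 3"
    unfolding power3_eq_cube mult.assoc using assms by (auto simp del: add_Suc_right intro: mult_left_mono mult_right_mono)
  have "?T = 24 + 60 * n + 62 * (n * n) + 54 * n ^ 3 + 16 * ?D + 20 * (?D * n) + 78 * (n * ?D) +
      112 * (n * (?D * ?D)) + 22 * (n * (?D * n)) + 54 * (n * (?D * (?D * ?D)))"
    by (simp add: power3_eq_cube algebra_simps)
  also have "\<dots> \<le> 1000 * (n ^ 3 + n * d ^ 3)"
  proof -
    have linear: "24 + 60 * n + 62 * p + 54 * q + 16 * D + 20 * x + 78 * y + 112 * z + 22 * u + 54 * v
        \<le> 1000 * (q + t)"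
      if "1 \<le> q" "n \<le> q" "p \<le> q" "v \<le> 8 * t + 8 * n" "D \<le> n" "x \<le> p" "y \<le> p" "u \<le> q" "z \<le> q"
      for p q D x y z u v t :: nat
      using that unfolding distrib_left by linarith
    show ?thesis by (rule linear[OF n3 lead mono])
  qed
  finally show ?thesis .
qed

lemma stress_program_correct:
  assumes dn: "d + 1 \<le> n" and gp: "general_position d n P"
    and lat: "lateration_ordering (d + 1) n E \<pi>" and input: "holds_input s d n E P \<pi>"
  shows "halts_within stress_program s (1000 * (n ^ 3 + n * d ^ 3))
    (\<lambda>s'. let S = output_matrix n s' in
       stress_matrix d n E P S \<and> positive_semidefinite n S \<and> vec_space.rank n S = n - d - 1)"
proof -
  have perm: "\<pi> permutes {..<n}" using lat by (simp add: lateration_ordering_def)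
  have pi: "\<pi> i < n" if "i < n" for i using permutes_in_image[OF perm] that by simp
  show ?thesis
    unfolding stress_program_def
  proof (rule halts_Seq[OF halts_load_points[OF input perm] _ stress_program_time[OF dn]], goal_cases)
    case (1 s1)
    have in1: "holds_input s1 d n E P \<pi>" by (rule holds_input_unchanged[OF input 1(1)]) auto
    show ?case
    proof (rule halts_Seq[OF halts_compute_columns[OF in1 lat gp] _ order.refl], goal_cases)
      case (2 s2)
      have in2: "holds_input s2 d n E P \<pi>" by (rule holds_input_unchanged[OF in1 2(1)]) auto
      show ?case
      proof (rule halts_conseq[OF halts_multiply_columns[OF in2 perm]], goal_cases)
        case (2 s3)
        show ?case
          unfolding Let_def
          by (rule stress_columns_yield_stress[OF lat, where U = "rarr s2 column_arr"])
             (use \<open>\<forall>k. d < k \<and> k < n \<longrightarrow> _\<close> 2(2) pi in \<open>auto simp: output_matrix_def\<close>)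
      qed simp
    qed (use 1(2) in auto)
  qed
qed

theorem theorem3:
  shows "(\<forall>d n E P.
            d + 1 \<le> n \<and> framework d n E P \<and> general_position d n P \<and>
            lateration_graph (d + 1) n E \<longrightarrow>
            (\<exists>S. stress_matrix d n E P S \<and> positive_semidefinite n S \<and>
                 vec_space.rank n S = n - d - 1)) \<and>
         (\<exists>(prog :: com) (C :: nat). \<forall>d n E P \<pi> s.
            d + 1 \<le> n \<and> framework d n E P \<and> general_position d n P \<and>
            lateration_ordering (d + 1) n E \<pi> \<and> holds_input s d n E P \<pi> \<longrightarrow>
            (\<exists>t s'. exec prog s t s' \<and> t \<le> C * (n ^ 3 + n * d ^ 3) \<and>
               (let S = output_matrix n s' in
                  stress_matrix d n E P S \<and> positive_semidefinite n S \<and>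
                  vec_space.rank n S = n - d - 1)))"
proof (intro conjI allI impI)
  fix d n E P
  assume "d + 1 \<le> n \<and> framework d n E P \<and> general_position d n P \<and> lateration_graph (d + 1) n E"
  then obtain \<pi> where dn: "d + 1 \<le> n" and gp: "general_position d n P"
    and lat: "lateration_ordering (d + 1) n E \<pi>" by (auto simp: lateration_graph_def)
  \<comment> \<open>Any memory that holds the input serves to run the program.\<close>
  define s where "s = \<lparr>ireg = (\<lambda>x. if x = 0 then n else d),
      iarr = (\<lambda>a i j. if a = 0 then \<pi> i else if {i, j} \<in> E then 1 else 0),
      rarr = (\<lambda>a i j. P $$ (i, j))\<rparr>"
  have "holds_input s d n E P \<pi>" by (simp add: s_def holds_input_def)
  from stress_program_correct[OF dn gp lat this]
  show "\<exists>S. stress_matrix d n E P S \<and> positive_semidefinite n S \<and> vec_space.rank n S = n - d - 1"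
    unfolding halts_within_def Let_def by blast
next
  show "\<exists>(prog :: com) (C :: nat). \<forall>d n E P \<pi> s.
            d + 1 \<le> n \<and> framework d n E P \<and> general_position d n P \<and>
            lateration_ordering (d + 1) n E \<pi> \<and> holds_input s d n E P \<pi> \<longrightarrow>
            (\<exists>t s'. exec prog s t s' \<and> t \<le> C * (n ^ 3 + n * d ^ 3) \<and>
               (let S = output_matrix n s' in
                  stress_matrix d n E P S \<and> positive_semidefinite n S \<and>
                  vec_space.rank n S = n - d - 1))"
    using stress_program_correct unfolding halts_within_def by blast
qed

end
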